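(* Let $G$ be a left ordered group, $H$ a torsion free nilpotent group, and $C$ a cyclic group equipped with injective homomorphisms into $G$ and into $H$. Then the free product with amalgamation $G*_CH$ is left orderable.
   Context: A left ordered group is a group with a total order $\le$ such that $x\le y\Rightarrow gx\le gy$ for all group elements $g,x,y$. *)

theory Defs
  imports "HOL-Algebra.Elementary_Groups"
begin

definition left_order :: "('a, 'b) monoid_scheme \<Rightarrow> ('a \<Rightarrow> 'a \<Rightarrow> bool) \<Rightarrow> bool" where
  "left_order G ord_rel \<longleftrightarrow>
     (\<forall>x\<in>carrier G. ord_rel x x) \<and>
     (\<forall>x\<in>carrier G. \<forall>y\<in>carrier G. ord_rel x y \<and> ord_rel y x \<longrightarrow> x = y) \<and>
     (\<forall>x\<in>carrier G. \<forall>y\<in>carrier G. \<forall>z\<in>carrier G. ord_rel x y \<and> ord_rel y z \<longrightarrow> ord_rel x z) \<and>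
     (\<forall>x\<in>carrier G. \<forall>y\<in>carrier G. ord_rel x y \<or> ord_rel y x) \<and>
     (\<forall>g\<in>carrier G. \<forall>x\<in>carrier G. \<forall>y\<in>carrier G. ord_rel x y \<longrightarrow> ord_rel (g \<otimes>\<^bsub>G\<^esub> x) (g \<otimes>\<^bsub>G\<^esub> y))"

definition left_orderable :: "('a, 'b) monoid_scheme \<Rightarrow> bool" where
  "left_orderable G \<longleftrightarrow> (\<exists>ord_rel. left_order G ord_rel)"

definition torsion_free :: "('a, 'b) monoid_scheme \<Rightarrow> bool" where
  "torsion_free G \<longleftrightarrow>
     (\<forall>x\<in>carrier G. \<forall>n::nat. n > 0 \<and> x [^]\<^bsub>G\<^esub> n = \<one>\<^bsub>G\<^esub> \<longrightarrow> x = \<one>\<^bsub>G\<^esub>)"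

fun lower_central :: "('a, 'b) monoid_scheme \<Rightarrow> nat \<Rightarrow> 'a set" where
  "lower_central G 0 = carrier G"
| "lower_central G (Suc n) =
     generate G {x \<otimes>\<^bsub>G\<^esub> y \<otimes>\<^bsub>G\<^esub> inv\<^bsub>G\<^esub> x \<otimes>\<^bsub>G\<^esub> inv\<^bsub>G\<^esub> y
                 | x y. x \<in> carrier G \<and> y \<in> lower_central G n}"

definition nilpotent :: "('a, 'b) monoid_scheme \<Rightarrow> bool" where
  "nilpotent G \<longleftrightarrow> (\<exists>n. lower_central G n = {\<one>\<^bsub>G\<^esub>})"

definition amal_words :: "('g, 'a) monoid_scheme \<Rightarrow> ('h, 'b) monoid_scheme \<Rightarrow> ('g + 'h) list set" where
  "amal_words G H = lists (Inl ` carrier G \<union> Inr ` carrier H)"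

inductive amal_rel ::
  "('g, 'a) monoid_scheme \<Rightarrow> ('h, 'b) monoid_scheme \<Rightarrow> ('c, 'd) monoid_scheme \<Rightarrow>
   ('c \<Rightarrow> 'g) \<Rightarrow> ('c \<Rightarrow> 'h) \<Rightarrow> ('g + 'h) list \<Rightarrow> ('g + 'h) list \<Rightarrow> bool"
  for G H C \<phi> \<psi> where
  refl: "w \<in> amal_words G H \<Longrightarrow> amal_rel G H C \<phi> \<psi> w w"
| sym: "amal_rel G H C \<phi> \<psi> u v \<Longrightarrow> amal_rel G H C \<phi> \<psi> v u"
| trans: "amal_rel G H C \<phi> \<psi> u v \<Longrightarrow> amal_rel G H C \<phi> \<psi> v w \<Longrightarrow> amal_rel G H C \<phi> \<psi> u w"
| cong: "amal_rel G H C \<phi> \<psi> u v \<Longrightarrow> a \<in> amal_words G H \<Longrightarrow> b \<in> amal_words G H \<Longrightarrow>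
         amal_rel G H C \<phi> \<psi> (a @ u @ b) (a @ v @ b)"
| one_G: "amal_rel G H C \<phi> \<psi> [Inl \<one>\<^bsub>G\<^esub>] []"
| one_H: "amal_rel G H C \<phi> \<psi> [Inr \<one>\<^bsub>H\<^esub>] []"
| mult_G: "x \<in> carrier G \<Longrightarrow> y \<in> carrier G \<Longrightarrow>
           amal_rel G H C \<phi> \<psi> [Inl x, Inl y] [Inl (x \<otimes>\<^bsub>G\<^esub> y)]"
| mult_H: "x \<in> carrier H \<Longrightarrow> y \<in> carrier H \<Longrightarrow>
           amal_rel G H C \<phi> \<psi> [Inr x, Inr y] [Inr (x \<otimes>\<^bsub>H\<^esub> y)]"
| amalg: "c \<in> carrier C \<Longrightarrow> amal_rel G H C \<phi> \<psi> [Inl (\<phi> c)] [Inr (\<psi> c)]"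

definition amalgamated_product ::
  "('g, 'a) monoid_scheme \<Rightarrow> ('h, 'b) monoid_scheme \<Rightarrow> ('c, 'd) monoid_scheme \<Rightarrow>
   ('c \<Rightarrow> 'g) \<Rightarrow> ('c \<Rightarrow> 'h) \<Rightarrow> ('g + 'h) list set monoid" where
  "amalgamated_product G H C \<phi> \<psi> =
     \<lparr> carrier = amal_words G H // {(u, v). amal_rel G H C \<phi> \<psi> u v},
       mult = (\<lambda>A B. {w. \<exists>a\<in>A. \<exists>b\<in>B. amal_rel G H C \<phi> \<psi> (a @ b) w}),
       one = {w. amal_rel G H C \<phi> \<psi> [] w} \<rparr>"

end

theory Submission
  imports Defs
begin

text \<open>
  A torsion free nilpotent group is left orderable because the factors of its upper central series
  are torsion free, so that cones on the successive factors can be combined lexicographically.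

  Let \<open>z\<close> generate the amalgamated cyclic group, with orders chosen such that \<open>z \<ge> 1\<close> on both sides.
  A left order on the amalgam is read off the orbit of a point with trivial stabilizer in an ordered set
  on which \<open>G\<close> and \<open>H\<close> act monotonically, with the same action of \<open>z\<close>. Such a set is the union of a
  tower. Suppose that \<open>H\<close> acts on \<open>X\<close> and \<open>G\<close> on a subset \<open>X'\<close>, and put \<open>P = X - X'\<close>. Call two points
  of \<open>P\<close> equivalent if each lies between two translates of the other under powers of \<open>z\<close>. The classes
  (bumps) are convex, and on each of them \<open>z\<close> moves all points up or all points down. If \<open>R\<close> consists of
  a fundamental interval of \<open>z\<close> in every bump, then \<open>G \<times>\<^sub>C P\<close> is \<open>G \<times> R\<close>, and it is ordered by
  the bump of the second entry, then by the order of \<open>G\<close> or its reverse according to the sign of the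
  bump, then by the order of \<open>R\<close>. Each point of \<open>G \<times>\<^sub>C P\<close> also determines a cut of \<open>X'\<close>; comparing cuts
  first yields an order on \<open>X' \<union> (G \<times>\<^sub>C P)\<close> that extends the one of \<open>X\<close> and is invariant under \<open>G\<close>.
\<close>

section \<open>Torsion free nilpotent groups\<close>

context group begin

section \<open>Commutators and the upper central series\<close>

lemma mult_inv_cancel:
  assumes "a \<in> carrier G" "b \<in> carrier G"
  shows "a \<otimes> (inv a \<otimes> b) = b" and "inv a \<otimes> (a \<otimes> b) = b"
  using assms by (simp_all add: m_assoc[symmetric])

text \<open>Rewrites group words to right-nested form with inverses on single letters and cancels
  adjacent inverse pairs, which settles the commutator identities below.\<close>

lemmas group_word_simps = m_assoc inv_mult_group mult_inv_cancel

text \<open>Stated through commutators to avoid quotient groups: the condition says that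
  \<open>x\<close> is central modulo the previous term.\<close>

fun upper_central :: "nat \<Rightarrow> 'a set" where
  "upper_central 0 = {\<one>}"
| "upper_central (Suc n) =
     {x \<in> carrier G. \<forall>y\<in>carrier G. y \<otimes> x \<otimes> inv y \<otimes> inv x \<in> upper_central n}"

lemma upper_central_subset: "upper_central n \<subseteq> carrier G"
  by (cases n) auto

lemma normalI_conj:
  assumes "subgroup N G" and "\<And>x y. x \<in> N \<Longrightarrow> y \<in> carrier G \<Longrightarrow> y \<otimes> x \<otimes> inv y \<otimes> inv x \<in> N"
  shows "N \<lhd> G"
proof (rule normal_invI[OF assms(1)])
  fix x h assume x: "x \<in> carrier G" and h: "h \<in> N"
  have hG: "h \<in> carrier G" by (rule subgroup.mem_carrier[OF assms(1) h])
  have "x \<otimes> h \<otimes> inv x = (x \<otimes> h \<otimes> inv x \<otimes> inv h) \<otimes> h"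
    using x hG by (simp add: m_assoc)
  then show "x \<otimes> h \<otimes> inv x \<in> N"
    using subgroup.m_closed[OF assms(1) assms(2)[OF h x] h] by simp
qed

lemma normal_conj_closed:
  assumes "N \<lhd> G" "n \<in> N" "x \<in> carrier G"
  shows "x \<otimes> n \<otimes> inv x \<in> N"
  using normal.inv_op_closed2[OF assms(1,3,2)] .

text \<open>Write \<open>[y, x]\<close> for \<open>y x y^-1 x^-1\<close>. Closure under inverses and
  products follows from \<open>[y, a^-1] = a^-1 [y, a]^-1 a\<close> and
  \<open>[y, a b] = [y, a] (a [y, b] a^-1)\<close>, since the previous term is normal. A commutator
  with an element of the new term lies in the previous one, whose own commutators stay there by
  normality.\<close>

lemma upper_central_normal: "upper_central n \<lhd> G"
proof (induction n)
  case 0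
  show ?case using one_is_normal by simp
next
  case (Suc n)
  then interpret N: normal "upper_central n" G .
  let ?N = "upper_central n"
  have "subgroup (upper_central (Suc n)) G"
  proof (rule subgroupI)
    show "upper_central (Suc n) \<subseteq> carrier G" by auto
    have "\<one> \<in> upper_central (Suc n)" using N.one_closed by auto
    then show "upper_central (Suc n) \<noteq> {}" by blast
  next
    fix a assume a: "a \<in> upper_central (Suc n)"
    have "y \<otimes> inv a \<otimes> inv y \<otimes> inv (inv a) \<in> ?N" if y: "y \<in> carrier G" for y
    proof -
      have aG: "a \<in> carrier G" using a by simp
      have "y \<otimes> a \<otimes> inv y \<otimes> inv a \<in> ?N" using a y by simp
      then have "inv (y \<otimes> a \<otimes> inv y \<otimes> inv a) \<in> ?N" by (rule N.m_inv_closed)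
      then have "inv a \<otimes> inv (y \<otimes> a \<otimes> inv y \<otimes> inv a) \<otimes> inv (inv a) \<in> ?N"
        using aG by (intro normal_conj_closed[OF Suc]) auto
      also have "inv a \<otimes> inv (y \<otimes> a \<otimes> inv y \<otimes> inv a) \<otimes> inv (inv a) = y \<otimes> inv a \<otimes> inv y \<otimes> inv (inv a)"
        using aG y by (simp add: group_word_simps)
      finally show ?thesis .
    qed
    then show "inv a \<in> upper_central (Suc n)" using a by simp
  next
    fix a b assume a: "a \<in> upper_central (Suc n)" and b: "b \<in> upper_central (Suc n)"
    then have G: "a \<in> carrier G" "b \<in> carrier G" by auto
    have "y \<otimes> (a \<otimes> b) \<otimes> inv y \<otimes> inv (a \<otimes> b) \<in> ?N" if y: "y \<in> carrier G" for y
    proof -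
      let ?u = "y \<otimes> a \<otimes> inv y \<otimes> inv a" and ?v = "y \<otimes> b \<otimes> inv y \<otimes> inv b"
      have "?u \<in> ?N" "?v \<in> ?N" using a b y by auto
      then have "?u \<otimes> (a \<otimes> ?v \<otimes> inv a) \<in> ?N"
        using normal_conj_closed[OF Suc] G by (blast intro: N.m_closed)
      also have "?u \<otimes> (a \<otimes> ?v \<otimes> inv a) = y \<otimes> (a \<otimes> b) \<otimes> inv y \<otimes> inv (a \<otimes> b)"
        using G y by (simp add: group_word_simps)
      finally show ?thesis .
    qed
    then show "a \<otimes> b \<in> upper_central (Suc n)" using G by simp
  qed
  moreover have "y \<otimes> x \<otimes> inv y \<otimes> inv x \<in> upper_central (Suc n)"
    if "x \<in> upper_central (Suc n)" "y \<in> carrier G" for x y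
  proof -
    let ?u = "y \<otimes> x \<otimes> inv y \<otimes> inv x"
    have u: "?u \<in> ?N" using that by simp
    then have uG: "?u \<in> carrier G" using N.mem_carrier by blast
    have "w \<otimes> ?u \<otimes> inv w \<otimes> inv ?u \<in> ?N" if "w \<in> carrier G" for w
      using normal_conj_closed[OF Suc u that] u by (blast intro: N.m_closed N.m_inv_closed)
    then show ?thesis using uG by simp
  qed
  ultimately show ?case by (rule normalI_conj)
qed

lemma lower_central_subset: "lower_central G n \<subseteq> carrier G"
proof (induction n)
  case (Suc n)
  then have "{x \<otimes> y \<otimes> inv x \<otimes> inv y | x y. x \<in> carrier G \<and> y \<in> lower_central G n} \<subseteq> carrier G"
    by blast
  from generate_incl[OF this] show ?case by simp
qed simp

text \<open>Commutators of elements of one lower central term lie in the next one, which by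
  induction lies in \<open>upper_central i\<close>; this is the defining condition of
  \<open>upper_central (Suc i)\<close>. At \<open>i = n\<close> it shows that the upper series
  reaches the whole group.\<close>

lemma lower_central_le_upper_central:
  assumes "lower_central G n = {\<one>}" and "i \<le> n"
  shows "lower_central G (n - i) \<subseteq> upper_central i"
  using assms(2)
proof (induction i)
  case 0
  then show ?case using assms by simp
next
  case (Suc i)
  then have eq: "n - i = Suc (n - Suc i)" by simp
  show ?case
  proof
    fix x assume x: "x \<in> lower_central G (n - Suc i)"
    then have xG: "x \<in> carrier G" using lower_central_subset by blast
    have "y \<otimes> x \<otimes> inv y \<otimes> inv x \<in> upper_central i" if "y \<in> carrier G" for y
    proof -
      have "y \<otimes> x \<otimes> inv y \<otimes> inv x \<in> lower_central G (n - i)"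
        unfolding eq lower_central.simps using that x by (blast intro: generate.incl)
      then show ?thesis using Suc by auto
    qed
    then show "x \<in> upper_central (Suc i)" using xG by simp
  qed
qed

lemma nilpotent_upper_central:
  assumes "nilpotent G" obtains n where "upper_central n = carrier G"
proof -
  obtain n where "lower_central G n = {\<one>}" using assms by (auto simp: nilpotent_def)
  from lower_central_le_upper_central[OF this, of n] upper_central_subset[of n] show ?thesis
    using that by auto
qed

text \<open>Modulo \<open>N\<close> the element \<open>u\<close> is central, so
  \<open>(u x)^n\<close> agrees with \<open>u^n x^n\<close>. In the induction step \<open>u\<close>
  is moved past \<open>x^n\<close> at the cost of the commutator \<open>?c\<close>, which lies in
  \<open>N\<close>.\<close>

lemma power_mult_central_mod:
  assumes N: "N \<lhd> G" and u: "u \<in> carrier G" and x: "x \<in> carrier G"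
    and cent: "\<And>y. y \<in> carrier G \<Longrightarrow> y \<otimes> u \<otimes> inv y \<otimes> inv u \<in> N"
  shows "(u \<otimes> x) [^] (n::nat) \<otimes> inv (u [^] n \<otimes> x [^] n) \<in> N"
proof (induction n)
  case 0
  interpret N: normal N G by (rule N)
  show ?case using N.one_closed by simp
next
  case (Suc n)
  interpret N: normal N G by (rule N)
  let ?w = "(u \<otimes> x) [^] n \<otimes> inv (u [^] n \<otimes> x [^] n)"
  let ?c = "x [^] n \<otimes> u \<otimes> inv (x [^] n) \<otimes> inv u"
  have wG: "?w \<in> carrier G" using u x by simp
  have c: "?c \<in> N" using cent x by simp
  then have "u [^] n \<otimes> ?c \<otimes> inv (u [^] n) \<in> N" using normal_conj_closed[OF N] u by blast
  then have "?w \<otimes> (u [^] n \<otimes> ?c \<otimes> inv (u [^] n)) \<in> N" using Suc by (rule N.m_closed[rotated])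
  also have "?w \<otimes> (u [^] n \<otimes> ?c \<otimes> inv (u [^] n)) =
      (u \<otimes> x) [^] Suc n \<otimes> inv (u [^] Suc n \<otimes> x [^] Suc n)"
  proof -
    let ?A = "(u \<otimes> x) [^] n" and ?U = "u [^] n" and ?X = "x [^] n"
    have G: "?A \<in> carrier G" "?U \<in> carrier G" "?X \<in> carrier G" using u x by auto
    have "?w \<otimes> (?U \<otimes> ?c \<otimes> inv ?U) = ?A \<otimes> (u \<otimes> (inv ?X \<otimes> (inv u \<otimes> inv ?U)))"
      using G u x by (simp add: group_word_simps)
    also have "\<dots> = ?A \<otimes> (u \<otimes> x) \<otimes> inv (?U \<otimes> u \<otimes> (?X \<otimes> x))"
      using G u x by (simp add: group_word_simps)
    finally show ?thesis using u x by simp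
  qed
  finally show ?case .
qed

lemma conj_pow:
  assumes "x \<in> carrier G" "y \<in> carrier G"
  shows "(y \<otimes> x \<otimes> inv y) [^] (n::nat) = y \<otimes> x [^] n \<otimes> inv y"
proof (induction n)
  case (Suc n)
  then show ?case using assms by (simp add: group_word_simps)
qed (use assms in simp)

text \<open>The factors of the upper central series are torsion free. Since
  \<open>y x y^-1 = u x\<close> with \<open>u = [y, x]\<close>, taking n-th powers gives
  \<open>u^n = [y, x^n]\<close> modulo the lower term. Thus \<open>u^n\<close> lies in that term,
  and the induction hypothesis applied to \<open>u\<close> puts \<open>u\<close> itself
  there.\<close>

lemma upper_central_isolated:
  assumes tf: "torsion_free G" and n: "n > (0::nat)"
    and x: "x \<in> upper_central (Suc i)" "x [^] n \<in> upper_central i"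
  shows "x \<in> upper_central i"
  using x
proof (induction i arbitrary: x)
  case 0
  then show ?case using tf n by (auto simp: torsion_free_def)
next
  case (Suc i)
  let ?N = "upper_central i"
  interpret N: normal ?N G by (rule upper_central_normal)
  have xG: "x \<in> carrier G" using Suc.prems by simp
  have "y \<otimes> x \<otimes> inv y \<otimes> inv x \<in> ?N" if y: "y \<in> carrier G" for y
  proof -
    let ?u = "y \<otimes> x \<otimes> inv y \<otimes> inv x"
    have u: "?u \<in> upper_central (Suc i)" using Suc.prems(1) y by simp
    have uG: "?u \<in> carrier G" using xG y by simp
    let ?U = "?u [^] n"
    have UG: "?U \<in> carrier G" using uG by simp
    have "(?u \<otimes> x) [^] n \<otimes> inv (?U \<otimes> x [^] n) \<in> ?N"
      using u by (intro power_mult_central_mod[OF upper_central_normal uG xG]) simp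
    moreover have "?u \<otimes> x = y \<otimes> x \<otimes> inv y" using xG y by (simp add: m_assoc)
    ultimately have 1: "y \<otimes> x [^] n \<otimes> inv y \<otimes> inv (?U \<otimes> x [^] n) \<in> ?N"
      using conj_pow[OF xG y] by simp
    have 2: "y \<otimes> x [^] n \<otimes> inv y \<otimes> inv (x [^] n) \<in> ?N"
      using Suc.prems(2) y by simp
    \<comment> \<open>The two elements just placed in \<open>?N\<close> differ by the factor
      \<open>?U\<close>, which this quotient isolates.\<close>
    have "inv (y \<otimes> x [^] n \<otimes> inv y \<otimes> inv (?U \<otimes> x [^] n)) \<otimes> (y \<otimes> x [^] n \<otimes> inv y \<otimes> inv (x [^] n)) \<in> ?N"
      using 1 2 by (blast intro: N.m_closed N.m_inv_closed)
    also have "inv (y \<otimes> x [^] n \<otimes> inv y \<otimes> inv (?U \<otimes> x [^] n)) \<otimes> (y \<otimes> x [^] n \<otimes> inv y \<otimes> inv (x [^] n)) = ?U"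
    proof -
      define X where "X = x [^] n"
      define V where "V = ?U"
      have "X \<in> carrier G" "V \<in> carrier G" using xG UG by (auto simp: X_def V_def)
      then have "inv (y \<otimes> X \<otimes> inv y \<otimes> inv (V \<otimes> X)) \<otimes> (y \<otimes> X \<otimes> inv y \<otimes> inv X) = V"
        using y by (simp add: group_word_simps)
      then show ?thesis by (simp add: X_def V_def)
    qed
    finally show ?thesis using Suc.IH[OF u] by blast
  qed
  then show ?case using xG by simp
qed

end

text \<open>For \<open>N\<close> normal in \<open>M\<close> this is the preimage in \<open>M\<close>
  of the nonnegative cone of a left invariant partial order on \<open>M/N\<close>.\<close>

definition relative_cone :: "('a, 'b) monoid_scheme \<Rightarrow> 'a set \<Rightarrow> 'a set \<Rightarrow> 'a set \<Rightarrow> bool" where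
  "relative_cone G N M P \<longleftrightarrow>
     N \<subseteq> P \<and> P \<subseteq> M \<and> (\<forall>x\<in>P. \<forall>y\<in>P. x \<otimes>\<^bsub>G\<^esub> y \<in> P) \<and> (\<forall>x\<in>P. inv\<^bsub>G\<^esub> x \<in> P \<longrightarrow> x \<in> N)"

section \<open>Positive cones on torsion free abelian factors and their lexicographic
  combination\<close>

context group begin

lemma nat_pow_closed_set:
  assumes "P \<subseteq> carrier G" "\<And>x y. x \<in> P \<Longrightarrow> y \<in> P \<Longrightarrow> x \<otimes> y \<in> P" "x \<in> P"
  shows "x [^] Suc n \<in> P"
  using assms by (induction n) auto

text \<open>Adjoin the nonnegative powers of \<open>x\<close> to \<open>P\<close>. The result is
  multiplicatively closed because commutators in \<open>M\<close> lie in \<open>N\<close>, so by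
  maximality it contains some \<open>q\<close> outside \<open>N\<close> together with
  \<open>inv q\<close>. Multiplying the two representations gives \<open>r x^(k+l) = 1\<close> with
  \<open>r\<close> in \<open>P\<close>.\<close>

lemma maximal_relative_cone_power:
  assumes M: "subgroup M G" and N: "subgroup N G" and comm: "\<And>x y. x \<in> M \<Longrightarrow> y \<in> M \<Longrightarrow> x \<otimes> y \<otimes> inv x \<otimes> inv y \<in> N"
    and P: "relative_cone G N M P"
    and max: "\<And>Q. relative_cone G N M Q \<Longrightarrow> P \<subseteq> Q \<Longrightarrow> Q = P"
    and x: "x \<in> M" "x \<notin> P"
  obtains m :: nat where "m > 0" "inv (x [^] m) \<in> P"
proof -
  define Q where "Q = {p \<otimes> x [^] k | p k. p \<in> P \<and> (k::nat) \<in> UNIV}"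
  have MG: "a \<in> carrier G" if "a \<in> M" for a by (rule subgroup.mem_carrier[OF M that])
  have PM: "a \<in> M" if "a \<in> P" for a using P that by (auto simp: relative_cone_def)
  have NP: "a \<in> P" if "a \<in> N" for a using P that by (auto simp: relative_cone_def)
  have PP: "a \<otimes> b \<in> P" if "a \<in> P" "b \<in> P" for a b using P that by (auto simp: relative_cone_def)
  have xk: "x [^] k \<in> M" for k :: nat
    by (induction k) (auto simp: subgroup.one_closed[OF M] x(1) intro: subgroup.m_closed[OF M])
  have xG: "x \<in> carrier G" using MG x(1) by blast
  have swap: "\<exists>r\<in>P. (p \<otimes> x [^] k) \<otimes> (q \<otimes> x [^] l) = r \<otimes> x [^] (k + l)"
    if "p \<in> P" "q \<in> P" for p q and k l :: nat
  proof
    let ?c = "x [^] k \<otimes> q \<otimes> inv (x [^] k) \<otimes> inv q"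
    have "?c \<in> N" by (rule comm[OF xk PM[OF that(2)]])
    then show "p \<otimes> (?c \<otimes> q) \<in> P" using that PP NP by blast
    have G: "p \<in> carrier G" "q \<in> carrier G" using that MG PM by auto
    define X where "X = x [^] k"
    define Y where "Y = x [^] l"
    have "X \<in> carrier G" "Y \<in> carrier G" using xG by (auto simp: X_def Y_def)
    moreover have "x [^] (k + l) = X \<otimes> Y" using xG by (simp add: X_def Y_def nat_pow_mult)
    ultimately show "(p \<otimes> x [^] k) \<otimes> (q \<otimes> x [^] l) = p \<otimes> (?c \<otimes> q) \<otimes> x [^] (k + l)"
      using G by (simp add: X_def[symmetric] Y_def[symmetric] group_word_simps)
  qed
  have "P \<subseteq> Q"
  proof
    fix p assume p: "p \<in> P"
    then have "p = p \<otimes> x [^] (0::nat)" using MG PM by simp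
    then show "p \<in> Q" unfolding Q_def using p by blast
  qed
  have "x = \<one> \<otimes> x [^] (1::nat)" using xG by simp
  then have "x \<in> Q" unfolding Q_def using NP subgroup.one_closed[OF N] by blast
  have "Q \<subseteq> M" unfolding Q_def using PM xk subgroup.m_closed[OF M] by blast
  have "a \<otimes> b \<in> Q" if "a \<in> Q" "b \<in> Q" for a b
    using that swap unfolding Q_def by blast
  \<comment> \<open>All other cone conditions hold for \<open>Q\<close>, so what fails is the
    condition on inverses.\<close>
  moreover have "\<not> relative_cone G N M Q" using max \<open>P \<subseteq> Q\<close> \<open>x \<in> Q\<close> x(2) by blast
  moreover have "N \<subseteq> Q" using NP \<open>P \<subseteq> Q\<close> by blast
  ultimately obtain q where q: "q \<in> Q" "inv q \<in> Q" "q \<notin> N"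
    using \<open>Q \<subseteq> M\<close> unfolding relative_cone_def by blast
  then obtain p k p' l where pk: "p \<in> P" "q = p \<otimes> x [^] (k::nat)" "p' \<in> P" "inv q = p' \<otimes> x [^] (l::nat)"
    unfolding Q_def by blast
  have G: "p \<in> carrier G" "p' \<in> carrier G" using pk MG PM by auto
  obtain r where r: "r \<in> P" "q \<otimes> inv q = r \<otimes> x [^] (k + l)"
    using swap[OF pk(1,3), of k l] unfolding pk(2,4)[symmetric] by blast
  have rG: "r \<in> carrier G" using r MG PM by auto
  have "q \<in> carrier G" using q \<open>Q \<subseteq> M\<close> MG by blast
  then have "r \<otimes> x [^] (k + l) = \<one>" using r by simp
  then have "inv (x [^] (k + l)) = r" using rG xG by (metis inv_equality nat_pow_closed)
  \<comment> \<open>If both exponents vanished, \<open>q\<close> and its inverse would already lie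
    in \<open>P\<close>, forcing \<open>q\<close> into \<open>N\<close>.\<close>
  moreover have kl: "k + l > 0"
  proof (rule ccontr)
    assume "\<not> k + l > 0"
    then have "q = p" "inv q = p'" using pk G by auto
    then show False using pk q P by (auto simp: relative_cone_def)
  qed
  ultimately show ?thesis using that[OF kl] r(1) by simp
qed

text \<open>A maximal cone, given by Zorn's lemma, is total: if neither \<open>x\<close> nor
  \<open>inv x\<close> belonged to it, a positive power of \<open>x\<close> and a negative one would
  both do so. A common multiple of the exponents would then put a power of \<open>x\<close> into
  \<open>N\<close>, hence \<open>x\<close> as well.\<close>

lemma relative_cone_exists:
  assumes M: "subgroup M G" and N: "subgroup N G" and NM: "N \<subseteq> M"
    and comm: "\<And>x y. x \<in> M \<Longrightarrow> y \<in> M \<Longrightarrow> x \<otimes> y \<otimes> inv x \<otimes> inv y \<in> N"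
    and iso: "\<And>x n. x \<in> M \<Longrightarrow> n > (0::nat) \<Longrightarrow> x [^] n \<in> N \<Longrightarrow> x \<in> N"
  obtains P where "relative_cone G N M P" "\<And>x. x \<in> M \<Longrightarrow> x \<in> P \<or> inv x \<in> P"
proof -
  have "relative_cone G N M N"
    using NM subgroup.m_closed[OF N] by (auto simp: relative_cone_def)
  moreover have "relative_cone G N M (\<Union>C)"
    if "C \<noteq> {}" "subset.chain {P. relative_cone G N M P} C" for C
  proof -
    have C: "relative_cone G N M P" if "P \<in> C" for P
      using that \<open>subset.chain _ C\<close> by (auto simp: subset.chain_def)
    have common: "\<exists>P\<in>C. a \<in> P \<and> b \<in> P" if "a \<in> \<Union>C" "b \<in> \<Union>C" for a b
      using that \<open>subset.chain _ C\<close> unfolding subset.chain_def by blast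
    have "a \<otimes> b \<in> \<Union>C" "inv a = b \<longrightarrow> a \<in> N" if ab: "a \<in> \<Union>C" "b \<in> \<Union>C" for a b
      using common[OF ab] C unfolding relative_cone_def by blast+
    moreover have "N \<subseteq> \<Union>C" "\<Union>C \<subseteq> M" using C \<open>C \<noteq> {}\<close> unfolding relative_cone_def by blast+
    ultimately show ?thesis unfolding relative_cone_def by blast
  qed
  ultimately obtain P where P: "relative_cone G N M P"
    and max: "\<And>Q. relative_cone G N M Q \<Longrightarrow> P \<subseteq> Q \<Longrightarrow> Q = P"
    using subset_Zorn_nonempty[of "{P. relative_cone G N M P}"] by blast
  have "x \<in> P \<or> inv x \<in> P" if x: "x \<in> M" for x
  proof (rule ccontr)
    assume nP: "\<not> (x \<in> P \<or> inv x \<in> P)"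
    have xG: "x \<in> carrier G" by (rule subgroup.mem_carrier[OF M x])
    have ix: "inv x \<in> M" by (rule subgroup.m_inv_closed[OF M x])
    obtain m :: nat where m: "m > 0" "inv (x [^] m) \<in> P"
      using maximal_relative_cone_power[OF M N comm P max x] nP by blast
    obtain m' :: nat where m': "m' > 0" "inv (inv x [^] m') \<in> P"
      using maximal_relative_cone_power[OF M N comm P max ix] nP by blast
    have xm': "x [^] m' \<in> P" using m'(2) xG by (simp add: nat_pow_inv)
    have PG: "P \<subseteq> carrier G" using P subgroup.subset[OF M] by (auto simp: relative_cone_def)
    have PP: "a \<otimes> b \<in> P" if "a \<in> P" "b \<in> P" for a b using P that by (auto simp: relative_cone_def)
    obtain k k' where k: "m = Suc k" "m' = Suc k'" using m(1) m'(1) by (auto simp: gr0_conv_Suc)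
    \<comment> \<open>Both powers are raised to the common exponent \<open>m * m'\<close>, so that
      an element and its inverse lie in \<open>P\<close>.\<close>
    have "(x [^] m') [^] m \<in> P" unfolding k(1) by (rule nat_pow_closed_set[OF PG PP xm'])
    moreover have "(x [^] m') [^] m = x [^] (m * m')" using xG by (simp add: nat_pow_pow mult.commute)
    moreover have "inv (x [^] m) [^] m' \<in> P" unfolding k(2) by (rule nat_pow_closed_set[OF PG PP m(2)])
    moreover have "inv (x [^] m) [^] m' = inv (x [^] (m * m'))"
      using xG by (simp add: nat_pow_inv nat_pow_pow)
    ultimately have "x [^] (m * m') \<in> N" using P by (auto simp: relative_cone_def)
    then have "x \<in> N" using iso[OF x, of "m * m'"] m m' by simp
    then show False using nP P by (auto simp: relative_cone_def)
  qed
  then show ?thesis using that P by blast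
qed

text \<open>The lexicographic cone: an element outside \<open>N\<close> is judged by its image in
  \<open>M/N\<close>, an element of \<open>N\<close> by \<open>P\<close>.\<close>

lemma relative_cone_extend:
  assumes N: "subgroup N G" and M: "subgroup M G"
    and P: "relative_cone G {\<one>} N P" and Q: "relative_cone G N M Q"
  shows "relative_cone G {\<one>} M (P \<union> (Q - N))"
proof -
  have QG: "a \<in> carrier G" if "a \<in> Q" for a
    using that Q subgroup.mem_carrier[OF M] by (auto simp: relative_cone_def)
  have N_Q: "a \<in> Q" if "a \<in> N" for a using that Q by (auto simp: relative_cone_def)
  have QQ: "a \<otimes> b \<in> Q" if "a \<in> Q" "b \<in> Q" for a b using that Q by (auto simp: relative_cone_def)
  have Qinv: "a \<in> N" if "a \<in> Q" "inv a \<in> Q" for a using that Q by (auto simp: relative_cone_def)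
  have PN: "a \<in> N" if "a \<in> P" for a using that P by (auto simp: relative_cone_def)
  \<comment> \<open>If \<open>a b\<close> lies in \<open>N\<close>, then
    \<open>inv a = b (a b)^-1\<close> and \<open>inv b = (a b)^-1 a\<close> lie in \<open>Q\<close>.
    So a product of elements of \<open>Q\<close> cannot fall into \<open>N\<close> unless both
    factors do.\<close>
  have QN: "a \<in> N \<and> b \<in> N" if "a \<in> Q" "b \<in> Q" "a \<otimes> b \<in> N" for a b
  proof -
    have G: "a \<in> carrier G" "b \<in> carrier G" using that QG by auto
    have i: "inv (a \<otimes> b) \<in> Q" using that(3) by (intro N_Q subgroup.m_inv_closed[OF N])
    have "b \<otimes> inv (a \<otimes> b) = inv a" "inv (a \<otimes> b) \<otimes> a = inv b"
      using G by (simp_all add: group_word_simps)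
    then show ?thesis using QQ[OF that(2) i] QQ[OF i that(1)] Qinv that by simp
  qed
  have "a \<otimes> b \<in> P \<union> (Q - N)" if "a \<in> P \<union> (Q - N)" "b \<in> P \<union> (Q - N)" for a b
  proof (cases "a \<in> P \<and> b \<in> P")
    case True
    then show ?thesis using P by (auto simp: relative_cone_def)
  next
    case False
    then have "\<not> (a \<in> N \<and> b \<in> N)" "a \<in> Q" "b \<in> Q" using that PN N_Q by auto
    then show ?thesis using QQ QN by blast
  qed
  moreover have "a = \<one>" if "a \<in> P \<union> (Q - N)" "inv a \<in> P \<union> (Q - N)" for a
  proof (cases "a \<in> P")
    case True
    then have "inv a \<in> N" using PN subgroup.m_inv_closed[OF N] by blast
    then show ?thesis using that True P by (auto simp: relative_cone_def)
  next
    case False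
    then have "a \<in> Q" "a \<notin> N" "inv a \<in> Q" using that PN N_Q by auto
    then show ?thesis using Qinv by blast
  qed
  moreover have "P \<union> (Q - N) \<subseteq> M" "{\<one>} \<subseteq> P \<union> (Q - N)"
    using P Q by (auto simp: relative_cone_def)
  ultimately show ?thesis unfolding relative_cone_def by blast
qed

lemma left_order_of_cone:
  assumes P: "relative_cone G {\<one>} (carrier G) P" and tot: "\<And>x. x \<in> carrier G \<Longrightarrow> x \<in> P \<or> inv x \<in> P"
  shows "left_order G (\<lambda>x y. inv x \<otimes> y \<in> P)"
proof -
  have PP: "a \<otimes> b \<in> P" if "a \<in> P" "b \<in> P" for a b
    using that P by (auto simp: relative_cone_def)
  have anti: "a = \<one>" if "a \<in> P" "inv a \<in> P" for a using that P by (auto simp: relative_cone_def)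
  have inv_eq: "inv (inv x \<otimes> y) = inv y \<otimes> x" if "x \<in> carrier G" "y \<in> carrier G" for x y
    using that by (simp add: inv_mult_group)
  have P1: "\<one> \<in> P" using P by (auto simp: relative_cone_def)
  show ?thesis unfolding left_order_def
  proof (intro conjI ballI impI)
    fix x assume "x \<in> carrier G"
    then show "inv x \<otimes> x \<in> P" using P1 by simp
  next
    fix x y assume xy: "x \<in> carrier G" "y \<in> carrier G" "inv x \<otimes> y \<in> P \<and> inv y \<otimes> x \<in> P"
    then have "inv x \<otimes> y = \<one>" using anti inv_eq by simp
    then show "x = y" using xy by (metis inv_equality inv_inv inv_closed)
  next
    fix x y z assume G: "x \<in> carrier G" "y \<in> carrier G" "z \<in> carrier G"
      and xyz: "inv x \<otimes> y \<in> P \<and> inv y \<otimes> z \<in> P"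
    have "(inv x \<otimes> y) \<otimes> (inv y \<otimes> z) = inv x \<otimes> z" using G by (simp add: group_word_simps)
    then show "inv x \<otimes> z \<in> P" using PP xyz by metis
  next
    fix x y assume "x \<in> carrier G" "y \<in> carrier G"
    then show "inv x \<otimes> y \<in> P \<or> inv y \<otimes> x \<in> P" using tot[of "inv x \<otimes> y"] inv_eq by simp
  next
    fix g x y assume "g \<in> carrier G" "x \<in> carrier G" "y \<in> carrier G" "inv x \<otimes> y \<in> P"
    then show "inv (g \<otimes> x) \<otimes> (g \<otimes> y) \<in> P" by (simp add: group_word_simps)
  qed
qed

text \<open>Climb the upper central series. Each factor is abelian by definition of the series and
  torsion free by \<open>upper_central_isolated\<close>, so it has a total cone, which extends the
  cone built so far.\<close>

lemma torsion_free_nilpotent_left_orderable: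
  assumes "nilpotent G" "torsion_free G"
  shows "left_orderable G"
proof -
  have sub: "subgroup (upper_central i) G" for i
    by (rule normal_imp_subgroup[OF upper_central_normal])
  have mono: "upper_central i \<subseteq> upper_central (Suc i)" for i
  proof
    fix x assume x: "x \<in> upper_central i"
    have "y \<otimes> x \<otimes> inv y \<otimes> inv x \<in> upper_central i" if "y \<in> carrier G" for y
      by (intro subgroup.m_closed[OF sub] subgroup.m_inv_closed[OF sub]
          normal_conj_closed[OF upper_central_normal] x that)
    then show "x \<in> upper_central (Suc i)" using x upper_central_subset by auto
  qed
  have "\<exists>P. relative_cone G {\<one>} (upper_central i) P \<and> (\<forall>x\<in>upper_central i. x \<in> P \<or> inv x \<in> P)" for i
  proof (induction i)
    case 0
    show ?case by (intro exI[of _ "{\<one>}"]) (auto simp: relative_cone_def)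
  next
    case (Suc i)
    then obtain P where P: "relative_cone G {\<one>} (upper_central i) P"
      "\<And>x. x \<in> upper_central i \<Longrightarrow> x \<in> P \<or> inv x \<in> P" by blast
    have "x \<otimes> y \<otimes> inv x \<otimes> inv y \<in> upper_central i"
      if "x \<in> upper_central (Suc i)" "y \<in> upper_central (Suc i)" for x y
      using that by simp
    moreover have "x \<in> upper_central i"
      if "x \<in> upper_central (Suc i)" "n > (0::nat)" "x [^] n \<in> upper_central i" for x n
      using upper_central_isolated[OF assms(2)] that by blast
    ultimately obtain Q where Q: "relative_cone G (upper_central i) (upper_central (Suc i)) Q"
      "\<And>x. x \<in> upper_central (Suc i) \<Longrightarrow> x \<in> Q \<or> inv x \<in> Q"
      using relative_cone_exists[OF sub sub mono] by blast
    have "x \<in> P \<union> (Q - upper_central i) \<or> inv x \<in> P \<union> (Q - upper_central i)"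
      if "x \<in> upper_central (Suc i)" for x
    proof (cases "x \<in> upper_central i")
      case True
      then show ?thesis using P(2) by blast
    next
      case False
      have "x \<in> carrier G" using that by simp
      then have "inv x \<notin> upper_central i"
        using False subgroup.m_inv_closed[OF sub, of "inv x"] by auto
      then show ?thesis using False Q(2)[OF that] by blast
    qed
    then show ?case using relative_cone_extend[OF sub sub P(1) Q(1)] by blast
  qed
  moreover obtain n where "upper_central n = carrier G" using nilpotent_upper_central assms(1) by blast
  ultimately obtain P where "relative_cone G {\<one>} (carrier G) P" "\<forall>x\<in>carrier G. x \<in> P \<or> inv x \<in> P"
    by metis
  then show ?thesis using left_order_of_cone unfolding left_orderable_def by blast
qed

end

section \<open>Ordered sets with an integer flow\<close>

definition linord :: "'x set \<Rightarrow> ('x \<Rightarrow> 'x \<Rightarrow> bool) \<Rightarrow> bool" where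
  "linord X leq \<longleftrightarrow>
     (\<forall>x\<in>X. leq x x) \<and>
     (\<forall>x\<in>X. \<forall>y\<in>X. leq x y \<and> leq y x \<longrightarrow> x = y) \<and>
     (\<forall>x\<in>X. \<forall>y\<in>X. \<forall>z\<in>X. leq x y \<and> leq y z \<longrightarrow> leq x z) \<and>
     (\<forall>x\<in>X. \<forall>y\<in>X. leq x y \<or> leq y x)"

lemma linordI:
  assumes "\<And>x. x \<in> X \<Longrightarrow> leq x x"
    and "\<And>x y. x \<in> X \<Longrightarrow> y \<in> X \<Longrightarrow> leq x y \<Longrightarrow> leq y x \<Longrightarrow> x = y"
    and "\<And>x y z. x \<in> X \<Longrightarrow> y \<in> X \<Longrightarrow> z \<in> X \<Longrightarrow> leq x y \<Longrightarrow> leq y z \<Longrightarrow> leq x z"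
    and "\<And>x y. x \<in> X \<Longrightarrow> y \<in> X \<Longrightarrow> leq x y \<or> leq y x"
  shows "linord X leq"
  unfolding linord_def using assms by blast

lemma linordD:
  assumes "linord X leq"
  shows linord_refl: "x \<in> X \<Longrightarrow> leq x x"
    and linord_antisym: "leq x y \<Longrightarrow> leq y x \<Longrightarrow> x \<in> X \<Longrightarrow> y \<in> X \<Longrightarrow> x = y"
    and linord_trans: "leq x y \<Longrightarrow> leq y z \<Longrightarrow> x \<in> X \<Longrightarrow> y \<in> X \<Longrightarrow> z \<in> X \<Longrightarrow> leq x z"
    and linord_total: "x \<in> X \<Longrightarrow> y \<in> X \<Longrightarrow> leq x y \<or> leq y x"
  using assms unfolding linord_def by blast+

lemma linord_subset:
  assumes "linord X leq" "Y \<subseteq> X"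
  shows "linord Y leq"
  using linordD[OF assms(1)] subsetD[OF assms(2)] by (intro linordI) metis+

lemma linord_converse:
  assumes "linord X leq"
  shows "linord X (\<lambda>x y. leq y x)"
  using linordD[OF assms] by (intro linordI) metis+

lemma linord_image:
  assumes "linord A leq" "\<And>x. x \<in> X \<Longrightarrow> f x \<in> A" "inj_on f X"
  shows "linord X (\<lambda>x y. leq (f x) (f y))"
  using linordD[OF assms(1)] assms(2) inj_onD[OF assms(3)] by (intro linordI) metis+

lemma left_order_iff:
  "left_order G r \<longleftrightarrow> linord (carrier G) r \<and>
     (\<forall>g\<in>carrier G. \<forall>x\<in>carrier G. \<forall>y\<in>carrier G. r x y \<longrightarrow> r (g \<otimes>\<^bsub>G\<^esub> x) (g \<otimes>\<^bsub>G\<^esub> y))"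
  unfolding left_order_def linord_def by (simp only: conj_assoc)

text \<open>\<open>D y x\<close> says that the point \<open>y\<close> outside \<open>X\<close> lies below \<open>x\<close>.\<close>

definition cut_merge ::
  "'x set \<Rightarrow> ('x \<Rightarrow> 'x \<Rightarrow> bool) \<Rightarrow> ('x \<Rightarrow> 'x \<Rightarrow> bool) \<Rightarrow> ('x \<Rightarrow> 'x \<Rightarrow> bool) \<Rightarrow> 'x \<Rightarrow> 'x \<Rightarrow> bool" where
  "cut_merge X leq D leq2 x y \<longleftrightarrow>
     (if x \<in> X then if y \<in> X then leq x y else \<not> D y x
      else if y \<in> X then D x y
      else (\<exists>z\<in>X. D x z \<and> \<not> D y z) \<or> ((\<forall>z\<in>X. D x z \<longleftrightarrow> D y z) \<and> leq2 x y))"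

text \<open>Each point of \<open>N\<close> determines an upper set of \<open>X\<close>. Points of
  \<open>N\<close> with different cuts are ordered by reverse inclusion of these sets, and
  \<open>leq2\<close> decides between points with the same cut.\<close>

lemma linord_cut_merge:
  assumes X: "linord X leq" and N: "linord N leq2" and disj: "X \<inter> N = {}"
    and D: "\<And>y x x'. y \<in> N \<Longrightarrow> x \<in> X \<Longrightarrow> x' \<in> X \<Longrightarrow> D y x \<Longrightarrow> leq x x' \<Longrightarrow> D y x'"
  shows "linord (X \<union> N) (cut_merge X leq D leq2)"
proof (rule linordI)
  \<comment> \<open>Upper sets of a linear order are nested, so any two cuts are comparable.\<close>
  have nested: "D y z" if "y \<in> N" "y' \<in> N" "z \<in> X" "w \<in> X" "D y w" "\<not> D y' w" "D y' z" for y y' z w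
    using that D linord_total[OF X] by metis
  note nX = disj[unfolded disjoint_iff]
  {
    fix x assume "x \<in> X \<union> N"
    then show "cut_merge X leq D leq2 x x"
      unfolding cut_merge_def using linord_refl[OF X] linord_refl[OF N] by auto
  }
  {
    fix x y assume "x \<in> X \<union> N" "y \<in> X \<union> N" "cut_merge X leq D leq2 x y" "cut_merge X leq D leq2 y x"
    then show "x = y"
      unfolding cut_merge_def using linord_antisym[OF X] linord_antisym[OF N] nested nX
      by (smt (verit) UnE)
  }
  {
    fix x y assume "x \<in> X \<union> N" "y \<in> X \<union> N"
    then show "cut_merge X leq D leq2 x y \<or> cut_merge X leq D leq2 y x"
      unfolding cut_merge_def using linord_total[OF X] linord_total[OF N] nX
      by (smt (verit) UnE)
  }
  {
    fix x y z assume m: "x \<in> X \<union> N" "y \<in> X \<union> N" "z \<in> X \<union> N"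
      and xy: "cut_merge X leq D leq2 x y" and yz: "cut_merge X leq D leq2 y z"
    show "cut_merge X leq D leq2 x z"
    proof (cases "y \<in> X")
      case True
      then show ?thesis
        using m xy yz linord_trans[OF X] linord_total[OF X] D nX unfolding cut_merge_def
        by (smt (verit) UnE)
    next
      case False
      then have y: "y \<in> N" using m by blast
      have step: "cut_merge X leq D leq2 x z" if "x \<in> N" "z \<in> N"
      proof -
        have "x \<notin> X" "z \<notin> X" using that nX by auto
        then show ?thesis
          using xy yz that y \<open>y \<notin> X\<close> linord_trans[OF N] nested unfolding cut_merge_def
          by (smt (verit))
      qed
      have "cut_merge X leq D leq2 x z" if "x \<in> X" "z \<in> X"
        using xy yz that y \<open>y \<notin> X\<close> D linord_total[OF X] unfolding cut_merge_def by (smt (verit))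
      moreover have "cut_merge X leq D leq2 x z" if "x \<in> X" "z \<in> N"
      proof -
        have "z \<notin> X" using that nX by auto
        then show ?thesis
          using xy yz that y \<open>y \<notin> X\<close> D nested unfolding cut_merge_def by (smt (verit))
      qed
      moreover have "cut_merge X leq D leq2 x z" if "x \<in> N" "z \<in> X"
      proof -
        have "x \<notin> X" using that nX by auto
        then show ?thesis
          using xy yz that y \<open>y \<notin> X\<close> D nested unfolding cut_merge_def by (smt (verit))
      qed
      ultimately show ?thesis using step m by blast
    qed
  }
qed

section \<open>Bumps and levels of an integer flow\<close>

locale int_flow =
  fixes P :: "'x set" and leq :: "'x \<Rightarrow> 'x \<Rightarrow> bool" and S :: "int \<Rightarrow> 'x \<Rightarrow> 'x"
  assumes lin: "linord P leq"
    and S_closed: "\<And>k x. x \<in> P \<Longrightarrow> S k x \<in> P"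
    and S_0: "\<And>x. x \<in> P \<Longrightarrow> S 0 x = x"
    and S_add: "\<And>k l x. x \<in> P \<Longrightarrow> S (k + l) x = S k (S l x)"
    and S_mono: "\<And>k x y. x \<in> P \<Longrightarrow> y \<in> P \<Longrightarrow> leq x y \<Longrightarrow> leq (S k x) (S k y)"
begin

definition bump :: "'x \<Rightarrow> 'x \<Rightarrow> bool" where
  "bump x y \<longleftrightarrow> (\<exists>m n. leq (S m x) y \<and> leq y (S n x))"

definition pos :: "'x \<Rightarrow> bool" where
  "pos x \<longleftrightarrow> leq x (S 1 x)"

lemma S_cancel: "x \<in> P \<Longrightarrow> S (- k) (S k x) = x" "x \<in> P \<Longrightarrow> S k (S (- k) x) = x"
  using S_add[of x "- k" k] S_add[of x k "- k"] S_0 by auto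

lemma S_le_iff: "x \<in> P \<Longrightarrow> y \<in> P \<Longrightarrow> leq (S k x) (S k y) \<longleftrightarrow> leq x y"
  using S_mono[of x y k] S_mono[of "S k x" "S k y" "- k"] S_cancel S_closed by auto

lemma S_le_swap:
  assumes "x \<in> P" "y \<in> P"
  shows "leq (S k x) y \<longleftrightarrow> leq x (S (- k) y)" and "leq x (S k y) \<longleftrightarrow> leq (S (- k) x) y"
  using S_le_iff[of x "S (- k) y" k] S_le_iff[of "S (- k) x" y k] S_cancel S_closed assms by auto

lemma bump_refl: "x \<in> P \<Longrightarrow> bump x x"
  unfolding bump_def using S_0 linord_refl[OF lin] by metis

lemma bump_sym: "x \<in> P \<Longrightarrow> y \<in> P \<Longrightarrow> bump x y \<Longrightarrow> bump y x"
  unfolding bump_def using S_le_swap by blast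

lemma bump_trans:
  assumes P: "x \<in> P" "y \<in> P" "z \<in> P" and "bump x y" "bump y z"
  shows "bump x z"
proof -
  obtain m n m' n' where "leq (S m x) y" "leq y (S n x)" "leq (S m' y) z" "leq z (S n' y)"
    using assms unfolding bump_def by blast
  then have "leq (S m' (S m x)) z" "leq z (S n' (S n x))"
    using P S_closed S_mono linord_trans[OF lin] by meson+
  then show ?thesis unfolding bump_def using S_add P by metis
qed

lemma bump_convex:
  assumes "x \<in> P" "y \<in> P" "w \<in> P" "bump x y" "leq x w" "leq w y"
  shows "bump x w"
  using assms S_0 S_closed linord_trans[OF lin] unfolding bump_def by metis

lemma bump_S: "x \<in> P \<Longrightarrow> bump x (S k x)"
  unfolding bump_def using linord_refl[OF lin] S_closed by blast

text \<open>By convexity, a point outside a bump lies on the same side of all its points.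
  Consequently distinct bumps are themselves linearly ordered.\<close>

lemma bump_left_cong:
  assumes "x \<in> P" "y \<in> P" "w \<in> P" "bump x y" "\<not> bump y w"
  shows "leq x w \<longleftrightarrow> leq y w"
proof -
  have "leq b w" if "a \<in> P" "b \<in> P" "bump a b" "\<not> bump b w" "leq a w" for a b
  proof (rule ccontr)
    assume "\<not> leq b w"
    then have "leq w b" using that assms(3) linord_total[OF lin] by blast
    then have "bump a w" using bump_convex[of a b w] that assms(3) by blast
    then show False using bump_trans[of b a w] bump_sym that assms(3) by blast
  qed
  then show ?thesis using assms bump_sym bump_trans by metis
qed

lemma bump_right_cong:
  assumes "x \<in> P" "y \<in> P" "w \<in> P" "bump x y" "\<not> bump y w"
  shows "leq w x \<longleftrightarrow> leq w y"
proof -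
  have "\<not> bump x w" using assms bump_sym bump_trans by metis
  then have "w \<noteq> x" "w \<noteq> y" using assms bump_refl by auto
  then have "leq w x \<longleftrightarrow> \<not> leq x w" "leq w y \<longleftrightarrow> \<not> leq y w"
    using assms linord_total[OF lin] linord_antisym[OF lin] by metis+
  then show ?thesis using bump_left_cong[OF assms] by simp
qed

lemma pos_iterate:
  assumes "b \<in> P" "pos b" "m \<le> n"
  shows "leq (S m b) (S n b)"
proof -
  have "leq (S m b) (S (m + int k) b)" for k
  proof (induction k)
    case 0
    show ?case using assms linord_refl[OF lin] S_closed by simp
  next
    case (Suc k)
    have "leq (S (m + int k) b) (S (m + int k) (S 1 b))"
      using assms S_mono S_closed unfolding pos_def by blast
    also have "S (m + int k) (S 1 b) = S (m + int (Suc k)) b"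
      using S_add[OF assms(1), of "m + int k" 1] by (simp add: ac_simps)
    finally show ?case using Suc linord_trans[OF lin] assms(1) S_closed by blast
  qed
  from this[of "nat (n - m)"] show ?thesis using assms by simp
qed

lemma int_last_true:
  fixes Q :: "int \<Rightarrow> bool"
  assumes "Q m" "\<not> Q (m + int n)"
  shows "\<exists>k. Q k \<and> \<not> Q (k + 1)"
  using assms
proof (induction n arbitrary: m)
  case (Suc n)
  then show ?case using Suc.IH[of "m + 1"] by (cases "Q (m + 1)") (auto simp: ac_simps)
qed simp

text \<open>For \<open>b\<close> moved up by \<open>S 1\<close>, the half-open intervals from
  \<open>S k b\<close> to \<open>S (k + 1) b\<close> partition the bump of \<open>b\<close>.\<close>

definition level :: "'x \<Rightarrow> 'x \<Rightarrow> int \<Rightarrow> bool" where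
  "level b y k \<longleftrightarrow> leq (S k b) y \<and> \<not> leq (S (k + 1) b) y"

lemma level_exists:
  assumes "b \<in> P" "y \<in> P" "pos b" "S 1 b \<noteq> b" "bump b y"
  shows "\<exists>k. level b y k"
proof -
  obtain m n where mn: "leq (S m b) y" "leq y (S n b)" using assms unfolding bump_def by blast
  \<comment> \<open>The bound is \<open>n + 1\<close> because \<open>y\<close> may equal
    \<open>S n b\<close>; it is strict since \<open>S 1\<close> moves \<open>b\<close>. The desired
    level is then the last translate of \<open>b\<close> not above \<open>y\<close>.\<close>
  have "\<not> leq (S (n + 1) b) y"
  proof
    assume "leq (S (n + 1) b) y"
    then have "leq (S (n + 1) b) (S n b)" using mn assms S_closed linord_trans[OF lin] by blast
    then have "leq (S n (S 1 b)) (S n b)" using S_add assms by simp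
    then have "leq (S 1 b) b" using S_le_iff assms S_closed by blast
    then show False using assms S_closed linord_antisym[OF lin] unfolding pos_def by blast
  qed
  moreover have "m < n + 1"
  proof (rule ccontr)
    assume "\<not> m < n + 1"
    then have "leq (S (n + 1) b) (S m b)" using pos_iterate assms by simp
    then show False using mn calculation assms S_closed linord_trans[OF lin] by blast
  qed
  ultimately show ?thesis unfolding level_def
    using int_last_true[of "\<lambda>k. leq (S k b) y" m "nat (n + 1 - m)"] mn(1) by simp
qed

lemma level_less:
  assumes "b \<in> P" "x \<in> P" "y \<in> P" "pos b" "level b x k" "level b y l" "k < l"
  shows "leq x y"
proof -
  have "leq x (S (k + 1) b)" using assms S_closed linord_total[OF lin] unfolding level_def by blast
  moreover have "leq (S (k + 1) b) (S l b)" using pos_iterate assms by simp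
  moreover have "leq (S l b) y" using assms unfolding level_def by blast
  ultimately show ?thesis using linord_trans[OF lin] assms S_closed by meson
qed

lemma level_unique:
  assumes "b \<in> P" "y \<in> P" "pos b" "level b y k" "level b y l"
  shows "k = l"
proof -
  have "\<not> i < j" if "level b y i" "level b y j" for i j
  proof
    assume "i < j"
    then have "leq (S (i + 1) b) (S j b)" using pos_iterate assms by simp
    then show False using that assms S_closed linord_trans[OF lin] unfolding level_def by blast
  qed
  then show ?thesis using assms by (meson linorder_neqE)
qed

lemma level_S:
  assumes "b \<in> P" "y \<in> P" "level b y k"
  shows "level b (S n y) (k + n)"
proof -
  have "S (k + n) b = S n (S k b)" "S (k + n + 1) b = S n (S (k + 1) b)"
    using S_add[OF assms(1), of n k] S_add[OF assms(1), of n "k + 1"] by (simp_all add: ac_simps)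
  then show ?thesis using assms S_le_iff S_closed unfolding level_def by simp
qed

text \<open>If \<open>y\<close> has level \<open>k\<close> over \<open>b\<close>, then
  \<open>S 1 y\<close> has level \<open>k + 1\<close>, hence lies above \<open>y\<close>.\<close>

lemma pos_bump_pos:
  assumes "b \<in> P" "y \<in> P" "pos b" "S 1 b \<noteq> b" "bump b y"
  shows "pos y"
proof -
  obtain k where "level b y k" using level_exists assms by blast
  then have "level b (S 1 y) (k + 1)" using level_S assms by blast
  then show ?thesis
    using level_less[OF _ _ _ _ \<open>level b y k\<close>] assms S_closed unfolding pos_def by simp
qed

text \<open>Reversing the order keeps the bumps and turns downward moving ones into upward moving
  ones, so that the results on positive bumps serve for both signs.\<close>

lemma converse_flow: "int_flow P (\<lambda>x y. leq y x) S"
  using linord_converse[OF lin] S_closed S_0 S_add S_mono by unfold_locales auto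

text \<open>\<open>f\<close> counts the translates of a base point chosen in every bump.\<close>

lemma bump_height:
  assumes fp: "\<And>x. x \<in> P \<Longrightarrow> S 1 x \<noteq> x"
  obtains f :: "'x \<Rightarrow> int" where
    "\<And>k x. x \<in> P \<Longrightarrow> f (S k x) = f x + k"
    "\<And>x y. x \<in> P \<Longrightarrow> y \<in> P \<Longrightarrow> bump x y \<Longrightarrow> pos x \<longleftrightarrow> pos y"
    "\<And>x y. x \<in> P \<Longrightarrow> y \<in> P \<Longrightarrow> bump x y \<Longrightarrow> f x < f y \<Longrightarrow> if pos x then leq x y else leq y x"
proof -
  interpret R: int_flow P "\<lambda>x y. leq y x" S by (rule converse_flow)
  have Rbump: "R.bump x y \<longleftrightarrow> bump x y" for x y
    unfolding bump_def R.bump_def by blast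
  have Rpos: "R.pos x" if "x \<in> P" "\<not> pos x" for x
    using that linord_total[OF lin] S_closed unfolding pos_def R.pos_def by blast
  have pos_cong: "pos x \<longleftrightarrow> pos y" if "x \<in> P" "y \<in> P" "bump x y" for x y
    using that pos_bump_pos fp bump_sym by blast
  \<comment> \<open>The predicate depends only on the bump of \<open>x\<close>, so all points of a
    bump receive the same base point.\<close>
  define b where "b x = (SOME w. w \<in> P \<and> bump x w)" for x
  have b: "b x \<in> P" "bump (b x) x" "bump x (b x)" if "x \<in> P" for x
  proof -
    have "b x \<in> P \<and> bump x (b x)" unfolding b_def
      by (rule someI[of _ x]) (use that bump_refl in blast)
    then show "b x \<in> P" "bump (b x) x" "bump x (b x)" using that bump_sym by auto
  qed
  have b_cong: "b x = b y" if "x \<in> P" "y \<in> P" "bump x y" for x y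
  proof -
    have "(w \<in> P \<and> bump x w) = (w \<in> P \<and> bump y w)" for w
      using that bump_sym bump_trans by blast
    then show ?thesis unfolding b_def by simp
  qed
  \<comment> \<open>In a downward bump levels are counted in the reversed order; this way
    \<open>S k\<close> raises the level by \<open>k\<close> for either sign.\<close>
  define lev where "lev x k \<longleftrightarrow> (if pos (b x) then level (b x) x k else R.level (b x) x k)" for x k
  define f where "f x = (SOME k. lev x k)" for x
  have lev_ex: "\<exists>k. lev x k" if "x \<in> P" for x
    using level_exists[OF b(1)[OF that] that _ fp b(2)[OF that]]
      R.level_exists[OF b(1)[OF that] that Rpos fp] b[OF that] Rbump
    unfolding lev_def by (cases "pos (b x)") auto
  then have f: "lev x (f x)" if "x \<in> P" for x
    using that unfolding f_def by (metis someI_ex)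
  have lev_unique: "k = l" if "x \<in> P" "lev x k" "lev x l" for x k l
    using level_unique[OF b(1)[OF that(1)] that(1), of k l]
      R.level_unique[OF b(1)[OF that(1)] that(1) Rpos[OF b(1)[OF that(1)]], of k l] that(2,3)
    unfolding lev_def by (cases "pos (b x)") auto
  show ?thesis
  proof
    fix k x assume x: "x \<in> P"
    have "b (S k x) = b x" using b_cong[of x "S k x"] x bump_S S_closed by simp
    then have "lev (S k x) (f x + k)"
      using f[OF x] x b level_S R.level_S unfolding lev_def by auto
    then show "f (S k x) = f x + k" using lev_unique f x S_closed by blast
  next
    fix x y assume xy: "x \<in> P" "y \<in> P" "bump x y" "f x < f y"
    have eq: "b y = b x" using b_cong[OF xy(1-3)] by simp
    have px: "pos x \<longleftrightarrow> pos (b x)" using pos_cong b xy by blast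
    show "if pos x then leq x y else leq y x"
    proof (cases "pos (b x)")
      case True
      then have "level (b x) x (f x)" "level (b x) y (f y)"
        using f[OF xy(1)] f[OF xy(2)] unfolding lev_def eq by auto
      then show ?thesis using level_less[OF b(1) xy(1,2)] xy True px by auto
    next
      case False
      then have "R.level (b x) x (f x)" "R.level (b x) y (f y)"
        using f[OF xy(1)] f[OF xy(2)] unfolding lev_def eq by auto
      then show ?thesis using R.level_less[OF b(1) xy(1,2)] xy False px Rpos[OF b(1)] by auto
    qed
  qed (fact pos_cong)
qed

end

section \<open>Extending a partial action\<close>

text \<open>Freeness is carried along because the next extension needs to know the stabilizers of
  the flow: \<open>S k x = x\<close> exactly when the k-th power of the amalgamated element is
  trivial.\<close>

definition ordered_action ::
  "('g, 'r) monoid_scheme \<Rightarrow> 'x set \<Rightarrow> ('x \<Rightarrow> 'x \<Rightarrow> bool) \<Rightarrow> ('g \<Rightarrow> 'x \<Rightarrow> 'x) \<Rightarrow> bool" where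
  "ordered_action G X leq act \<longleftrightarrow>
     (\<forall>g\<in>carrier G. \<forall>x\<in>X. act g x \<in> X) \<and>
     (\<forall>x\<in>X. act \<one>\<^bsub>G\<^esub> x = x) \<and>
     (\<forall>g\<in>carrier G. \<forall>h\<in>carrier G. \<forall>x\<in>X. act (g \<otimes>\<^bsub>G\<^esub> h) x = act g (act h x)) \<and>
     (\<forall>g\<in>carrier G. \<forall>x\<in>X. \<forall>y\<in>X. leq x y \<longrightarrow> leq (act g x) (act g y)) \<and>
     (\<forall>g\<in>carrier G. \<forall>x\<in>X. act g x = x \<longrightarrow> g = \<one>\<^bsub>G\<^esub>)"

lemma ordered_actionD:
  assumes "ordered_action G X leq act"
  shows ordered_action_closed: "\<And>g x. g \<in> carrier G \<Longrightarrow> x \<in> X \<Longrightarrow> act g x \<in> X"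
    and ordered_action_one: "\<And>x. x \<in> X \<Longrightarrow> act \<one>\<^bsub>G\<^esub> x = x"
    and ordered_action_mult: "\<And>g h x. g \<in> carrier G \<Longrightarrow> h \<in> carrier G \<Longrightarrow> x \<in> X \<Longrightarrow>
      act (g \<otimes>\<^bsub>G\<^esub> h) x = act g (act h x)"
    and ordered_action_mono: "\<And>g x y. g \<in> carrier G \<Longrightarrow> x \<in> X \<Longrightarrow> y \<in> X \<Longrightarrow> leq x y \<Longrightarrow> leq (act g x) (act g y)"
    and ordered_action_free: "\<And>g x. g \<in> carrier G \<Longrightarrow> x \<in> X \<Longrightarrow> act g x = x \<Longrightarrow> g = \<one>\<^bsub>G\<^esub>"
  using assms unfolding ordered_action_def by (simp, simp, simp, simp, metis)

lemma (in group) ordered_action_inv: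
  assumes "ordered_action G X leq act" "g \<in> carrier G" "x \<in> X"
  shows "act (inv g) (act g x) = x" and "act g (act (inv g) x) = x"
  using ordered_action_mult[OF assms(1), of "inv g" g x] ordered_action_mult[OF assms(1), of g "inv g" x]
    ordered_action_one[OF assms(1,3)] assms by simp_all

lemma (in group) left_order_pow_mono:
  assumes "left_order G r" "z \<in> carrier G" "r \<one> z" "m \<le> (n::int)"
  shows "r (z [^] m) (z [^] n)"
proof -
  have lin: "linord (carrier G) r"
    and inv: "\<And>g x y. g \<in> carrier G \<Longrightarrow> x \<in> carrier G \<Longrightarrow> y \<in> carrier G \<Longrightarrow> r x y \<Longrightarrow> r (g \<otimes> x) (g \<otimes> y)"
    using assms(1) unfolding left_order_iff by auto
  have "r (z [^] m) (z [^] (m + int k))" for k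
  proof (induction k)
    case 0
    show ?case using linord_refl[OF lin] assms(2) by simp
  next
    case (Suc k)
    have "r (z [^] (m + int k) \<otimes> \<one>) (z [^] (m + int k) \<otimes> z)"
      using inv[of "z [^] (m + int k)" \<one> z] assms(2,3) by simp
    moreover have "z [^] (m + int k) \<otimes> z = z [^] (m + int (Suc k))"
      using int_pow_mult[OF assms(2), of "m + int k" 1] assms(2) by (simp add: ac_simps)
    ultimately have "r (z [^] (m + int k)) (z [^] (m + int (Suc k)))"
      using assms(2) by simp
    then show ?case using linord_trans[OF lin Suc] assms(2) by blast
  qed
  from this[of "nat (n - m)"] show ?thesis using assms(4) by simp
qed

text \<open>The points of \<open>X - X'\<close> are to be moved by all of \<open>G\<close>, freely apart from the amalgamation of
  \<open>z\<close> with \<open>S 1\<close>; \<open>new g p\<close> is a name for the point \<open>g p\<close>. In the application \<open>\<rho>\<close> maps a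
  word to its class in the amalgam, and its equivariance replaces the normal form theorem: it shows that
  the point at which the orbit map is taken has trivial stabilizer.\<close>

locale amalgam_step = group G for G :: "('g, 'r) monoid_scheme" (structure) +
  fixes gleq :: "'g \<Rightarrow> 'g \<Rightarrow> bool" and z :: 'g
    and X' X :: "'x set" and leq :: "'x \<Rightarrow> 'x \<Rightarrow> bool"
    and \<beta> :: "'g \<Rightarrow> 'x \<Rightarrow> 'x" and S :: "int \<Rightarrow> 'x \<Rightarrow> 'x" and new :: "'g \<Rightarrow> 'x \<Rightarrow> 'x"
    and L :: "'g \<Rightarrow> 'w \<Rightarrow> 'w" and W :: "'w set" and \<rho> :: "'x \<Rightarrow> 'w"
  assumes gord: "left_order G gleq" and z: "z \<in> carrier G" "gleq \<one> z"
    and X'X: "X' \<subseteq> X"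
    and \<beta>: "ordered_action G X' leq \<beta>"
    and flow: "int_flow X leq S"
    and S_free: "\<And>x k. x \<in> X \<Longrightarrow> S k x = x \<longleftrightarrow> z [^] k = \<one>"
    and \<beta>_z: "\<And>x k. x \<in> X' \<Longrightarrow> \<beta> (z [^] k) x = S k x"
    and new_inj: "\<And>g h p q. g \<in> carrier G \<Longrightarrow> h \<in> carrier G \<Longrightarrow> p \<in> X - X' \<Longrightarrow> q \<in> X - X' \<Longrightarrow>
      new g p = new h q \<Longrightarrow> g = h \<and> p = q"
    and new_fresh: "\<And>g p. g \<in> carrier G \<Longrightarrow> p \<in> X - X' \<Longrightarrow> new g p \<notin> X"
    and L_closed: "\<And>g w. g \<in> carrier G \<Longrightarrow> w \<in> W \<Longrightarrow> L g w \<in> W"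
    and L_mult: "\<And>g h w. g \<in> carrier G \<Longrightarrow> h \<in> carrier G \<Longrightarrow> w \<in> W \<Longrightarrow> L (g \<otimes> h) w = L g (L h w)"
    and \<rho>_W: "\<And>x. x \<in> X \<Longrightarrow> \<rho> x \<in> W"
    and \<rho>_\<beta>: "\<And>g x. g \<in> carrier G \<Longrightarrow> x \<in> X' \<Longrightarrow> \<rho> (\<beta> g x) = L g (\<rho> x)"
    and \<rho>_S: "\<And>k x. x \<in> X \<Longrightarrow> \<rho> (S k x) = L (z [^] k) (\<rho> x)"
    and \<rho>_new: "\<And>g p. g \<in> carrier G \<Longrightarrow> p \<in> X - X' \<Longrightarrow> \<rho> (new g p) = L g (\<rho> p)"
begin

sublocale X: int_flow X leq S by (rule flow)

abbreviation "P \<equiv> X - X'"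

lemma S_X': "x \<in> X' \<Longrightarrow> S k x \<in> X'"
  using \<beta>_z[of x k] ordered_action_closed[OF \<beta>, of "z [^] k" x] z by simp

lemma S_P:
  assumes "p \<in> P" shows "S k p \<in> P"
  using S_X'[of "S k p" "- k"] X.S_cancel(1)[of p k] X.S_closed[of p k] assms by auto

sublocale F: int_flow P leq S
  using linord_subset[OF X.lin] S_P X.S_0 X.S_add X.S_mono by unfold_locales auto

lemma gleq_linord: "linord (carrier G) gleq"
  and gleq_mult: "g \<in> carrier G \<Longrightarrow> x \<in> carrier G \<Longrightarrow> y \<in> carrier G \<Longrightarrow> gleq x y \<Longrightarrow> gleq (g \<otimes> x) (g \<otimes> y)"
  using gord unfolding left_order_iff by auto

section \<open>Heights and a fundamental domain for the flow on \<open>P\<close>\<close>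

lemma S_eq_iff:
  assumes "x \<in> X" shows "S m x = S n x \<longleftrightarrow> z [^] m = z [^] n"
proof -
  have "S m x = S n (S (m - n) x)" using X.S_add[OF assms, of n "m - n"] by simp
  then have "S m x = S n x \<longleftrightarrow> S (m - n) x = x"
    using X.S_cancel(1)[of "S (m - n) x" n] X.S_cancel(1)[of x n] X.S_closed assms by metis
  also have "\<dots> \<longleftrightarrow> z [^] (m - n) = \<one>" using S_free assms by simp
  also have "\<dots> \<longleftrightarrow> z [^] m = z [^] n" using z by (simp add: int_pow_diff inv_solve_right')
  finally show ?thesis .
qed

text \<open>The case \<open>z = \<one>\<close> is separate: the flow is then the identity, and no
  function on a nonempty \<open>P\<close> could grow by \<open>k\<close> under
  \<open>S k\<close>.\<close>

definition height_spec :: "('x \<Rightarrow> int) \<Rightarrow> bool" where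
  "height_spec f \<longleftrightarrow>
     (if z = \<one> then \<forall>p\<in>P. f p = 0 else \<forall>p\<in>P. \<forall>k. f (S k p) = f p + k) \<and>
     (\<forall>p\<in>P. \<forall>q\<in>P. F.bump p q \<and> f p < f q \<longrightarrow> (if F.pos p then leq p q else leq q p))"

definition f :: "'x \<Rightarrow> int" where
  "f = (SOME f. height_spec f)"

lemma S_trivial: "z = \<one> \<Longrightarrow> x \<in> X \<Longrightarrow> S k x = x"
  using S_free by simp

lemma S_nontrivial: "z \<noteq> \<one> \<Longrightarrow> x \<in> X \<Longrightarrow> S 1 x \<noteq> x"
  using S_free[of x 1] z by simp

lemma height_exists: "\<exists>f. height_spec f"
proof (cases "z = \<one>")
  case True
  then have "height_spec (\<lambda>_. 0)" unfolding height_spec_def by simp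
  then show ?thesis by blast
next
  case False
  obtain f where f: "\<And>k x. x \<in> P \<Longrightarrow> f (S k x) = f x + k"
    "\<And>x y. x \<in> P \<Longrightarrow> y \<in> P \<Longrightarrow> F.bump x y \<Longrightarrow> f x < f y \<Longrightarrow> if F.pos x then leq x y else leq y x"
    using F.bump_height S_nontrivial[OF False] by (metis DiffD1)
  have "height_spec f" unfolding height_spec_def using f False by auto
  then show ?thesis by blast
qed

lemma height_spec_f: "height_spec f"
  unfolding f_def using height_exists by (rule someI_ex)

lemma f_trivial: "z = \<one> \<Longrightarrow> p \<in> P \<Longrightarrow> f p = 0"
  and f_S: "z \<noteq> \<one> \<Longrightarrow> p \<in> P \<Longrightarrow> f (S k p) = f p + k"
  and f_less: "p \<in> P \<Longrightarrow> q \<in> P \<Longrightarrow> F.bump p q \<Longrightarrow> f p < f q \<Longrightarrow> if F.pos p then leq p q else leq q p"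
  using height_spec_f unfolding height_spec_def by auto

text \<open>For \<open>z = \<one>\<close> all points are fixed and \<open>pos\<close> holds
  everywhere. Otherwise no point is fixed, and \<open>pos_bump_pos\<close> applies in both
  directions.\<close>

lemma pos_cong:
  assumes "p \<in> P" "q \<in> P" "F.bump p q"
  shows "F.pos p \<longleftrightarrow> F.pos q"
proof (cases "z = \<one>")
  case True
  then show ?thesis using assms S_trivial linord_refl[OF X.lin] unfolding F.pos_def by auto
next
  case False
  then have "S 1 p \<noteq> p" "S 1 q \<noteq> q" using S_nontrivial assms by auto
  then show ?thesis using F.pos_bump_pos F.bump_sym assms by blast
qed

text \<open>A fundamental domain: every orbit of the flow on \<open>P\<close> meets \<open>R\<close>
  in exactly one point, namely \<open>base p\<close> for the orbit of \<open>p\<close>. For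
  \<open>z = \<one>\<close> it is all of \<open>P\<close>.\<close>

definition R :: "'x set" where
  "R = {r \<in> P. f r = 0}"

definition base :: "'x \<Rightarrow> 'x" where
  "base p = S (- f p) p"

lemma R_P: "r \<in> R \<Longrightarrow> r \<in> P" by (simp add: R_def)

lemma R_X: "r \<in> R \<Longrightarrow> r \<in> X" by (simp add: R_def)

lemma base_R: "p \<in> P \<Longrightarrow> base p \<in> R"
  unfolding base_def R_def using S_P f_S f_trivial by (cases "z = \<one>") auto

lemma S_base: "p \<in> P \<Longrightarrow> S (f p) (base p) = p"
  unfolding base_def by (simp add: X.S_cancel)

lemma R_unique:
  assumes "r \<in> R" "r' \<in> R" "S m r = S n r'"
  shows "z [^] m = z [^] n \<and> r = r'"
proof (cases "z = \<one>")
  case True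
  then show ?thesis using assms S_trivial R_X by simp
next
  case False
  then have "m = n" using assms f_S[of r m] f_S[of r' n] unfolding R_def by auto
  then show ?thesis using assms X.S_cancel(1)[of r m] X.S_cancel(1)[of r' m] R_X by metis
qed

text \<open>The point of \<open>G \<times>\<^sub>C P\<close> represented by \<open>(g, r)\<close>.
  For a power of \<open>z\<close> it has to be the existing point of \<open>X\<close>; all other
  group elements produce fresh names.\<close>

definition j :: "'g \<Rightarrow> 'x \<Rightarrow> 'x" where
  "j g r = (if \<exists>m::int. g = z [^] m then S (SOME m. g = z [^] m) r else new g r)"

lemma j_pow:
  assumes "r \<in> X" shows "j (z [^] (m::int)) r = S m r"
proof -
  define n where "n = (SOME n::int. z [^] m = z [^] n)"
  \<comment> \<open>The chosen exponent may differ from \<open>m\<close>, but equal powers of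
    \<open>z\<close> act equally through \<open>S\<close>.\<close>
  have "z [^] m = z [^] n" unfolding n_def by (rule someI[of _ m]) simp
  then have "S n r = S m r" using S_eq_iff[OF assms] by simp
  then show ?thesis unfolding j_def n_def by auto
qed

lemma j_cases:
  obtains (pow) m :: int where "g = z [^] m" "\<And>r. r \<in> X \<Longrightarrow> j g r = S m r"
  | (new) "\<nexists>m::int. g = z [^] m" "\<And>r. j g r = new g r"
  using j_pow unfolding j_def by metis

lemma j_not_X': "g \<in> carrier G \<Longrightarrow> r \<in> R \<Longrightarrow> j g r \<notin> X'"
  using S_P new_fresh X'X R_P R_X by (cases g rule: j_cases) auto

text \<open>The pairs in \<open>carrier G \<times> R\<close> are coordinates on
  \<open>G \<times>\<^sub>C P\<close>. Old points are separated by \<open>R_unique\<close>, fresh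
  ones by injectivity of \<open>new\<close>, and freshness keeps the two kinds apart.\<close>

lemma j_inj:
  assumes g: "g \<in> carrier G" "h \<in> carrier G" and r: "r \<in> R" "s \<in> R" and eq: "j g r = j h s"
  shows "g = h \<and> r = s"
proof (cases g rule: j_cases)
  case (pow m)
  then have m: "j g r = S m r" "j g r \<in> X" using R_X r X.S_closed by auto
  show ?thesis
  proof (cases h rule: j_cases)
    case (pow n)
    then show ?thesis using R_unique[OF r, of m n] m eq \<open>g = z [^] m\<close> R_X r by simp
  next
    case new
    then show ?thesis using m eq new_fresh[of h s] g r R_P by auto
  qed
next
  case new
  note n = this
  show ?thesis
  proof (cases h rule: j_cases)
    case (pow m)
    then have "j h s \<in> X" using R_X r X.S_closed by auto
    then show ?thesis using n eq new_fresh[of g r] g r R_P by auto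
  next
    case new
    then show ?thesis using new_inj[of g h r s] n eq g r R_P by simp
  qed
qed

section \<open>Order and action on the extended set \<open>X' \<union> N\<close>\<close>

definition N :: "'x set" where
  "N = (\<lambda>(g, r). j g r) ` (carrier G \<times> R)"

definition dec :: "'x \<Rightarrow> 'g \<times> 'x" where
  "dec = inv_into (carrier G \<times> R) (\<lambda>(g, r). j g r)"

lemma dec_j: "g \<in> carrier G \<Longrightarrow> r \<in> R \<Longrightarrow> dec (j g r) = (g, r)"
proof -
  assume a: "g \<in> carrier G" "r \<in> R"
  have "inj_on (\<lambda>(g, r). j g r) (carrier G \<times> R)"
    using j_inj by (auto simp: inj_on_def)
  from inv_into_f_f[OF this, of "(g, r)"] show ?thesis unfolding dec_def using a by simp
qed

lemma N_cases:
  assumes "y \<in> N"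
  obtains g r where "g \<in> carrier G" "r \<in> R" "y = j g r"
  using assms unfolding N_def by auto

lemma j_N: "g \<in> carrier G \<Longrightarrow> r \<in> R \<Longrightarrow> j g r \<in> N"
  unfolding N_def by auto

lemma N_X': "X' \<inter> N = {}"
  using j_not_X' by (auto elim: N_cases)

lemma P_j: "p \<in> P \<Longrightarrow> p = j (z [^] f p) (base p)"
  using j_pow[of "base p" "f p"] S_base[of p] R_X[OF base_R] by simp

lemma P_N: "P \<subseteq> N"
  using P_j j_N base_R z by (metis int_pow_closed subsetI)

lemma dec_P: "p \<in> P \<Longrightarrow> dec p = (z [^] f p, base p)"
  using dec_j[of "z [^] f p" "base p"] P_j base_R z by simp

text \<open>Across different bumps, comparing the second entries compares the bumps; with equal
  group entries it is the last criterion, so the two share a branch. The reversal in downward bumps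
  is forced by agreement with \<open>leq\<close>: there \<open>S m r\<close> decreases with
  \<open>m\<close>, while \<open>z [^] m\<close> does not.\<close>

definition key_leq :: "'g \<times> 'x \<Rightarrow> 'g \<times> 'x \<Rightarrow> bool" where
  "key_leq a b \<longleftrightarrow>
     (if \<not> F.bump (snd a) (snd b) \<or> fst a = fst b then leq (snd a) (snd b)
      else if F.pos (snd a) then gleq (fst a) (fst b) else gleq (fst b) (fst a))"

text \<open>Transitivity is checked according to which of the second entries share a bump. If only
  two neighbours do, one is replaced by the other in comparisons with the third point; signs agree
  within a bump by \<open>pos_cong\<close>.\<close>

lemma key_leq_linord: "linord (carrier G \<times> R) key_leq"
proof (rule linordI)
  fix a assume "a \<in> carrier G \<times> R"
  then have "snd a \<in> P" using R_P by auto
  then show "key_leq a a" using linord_refl[OF F.lin] unfolding key_leq_def by auto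
next
  fix a b assume ab: "a \<in> carrier G \<times> R" "b \<in> carrier G \<times> R"
  then have P: "snd a \<in> P" "snd b \<in> P" and G: "fst a \<in> carrier G" "fst b \<in> carrier G"
    using R_P by auto
  have sym: "F.bump (snd b) (snd a) \<longleftrightarrow> F.bump (snd a) (snd b)" using F.bump_sym P by blast
  note pc = pos_cong[OF P]
  show "key_leq a b \<or> key_leq b a"
    using linord_total[OF F.lin P] linord_total[OF gleq_linord G] sym pc
    unfolding key_leq_def by auto
  assume k: "key_leq a b" "key_leq b a"
  show "a = b"
  proof (cases "\<not> F.bump (snd a) (snd b) \<or> fst a = fst b")
    case True
    then have "snd a = snd b"
      using k sym linord_antisym[OF F.lin _ _ P] unfolding key_leq_def by auto
    then show ?thesis using True F.bump_refl P by (auto simp: prod_eq_iff)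
  next
    case False
    then have "fst a = fst b"
      using k sym pc linord_antisym[OF gleq_linord _ _ G] unfolding key_leq_def by (auto split: if_splits)
    then show ?thesis using False by blast
  qed
next
  fix a b c assume abc: "a \<in> carrier G \<times> R" "b \<in> carrier G \<times> R" "c \<in> carrier G \<times> R"
    and k: "key_leq a b" "key_leq b c"
  define r s t where "r = snd a" and "s = snd b" and "t = snd c"
  define g h i where "g = fst a" and "h = fst b" and "i = fst c"
  have P: "r \<in> P" "s \<in> P" "t \<in> P" and G: "g \<in> carrier G" "h \<in> carrier G" "i \<in> carrier G"
    using R_P abc by (auto simp: r_def s_def t_def g_def h_def i_def)
  note defs = r_def[symmetric] s_def[symmetric] t_def[symmetric] g_def[symmetric] h_def[symmetric] i_def[symmetric]
  note k' = k[unfolded key_leq_def defs]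
  have leq_trans: "leq r s \<Longrightarrow> leq s t \<Longrightarrow> leq r t" using linord_trans[OF F.lin] P by blast
  have "if \<not> F.bump r t \<or> g = i then leq r t else if F.pos r then gleq g i else gleq i g"
  proof (cases "F.bump r s")
    case rs: True
    show ?thesis
    proof (cases "F.bump s t")
      case True
      have "F.bump r t" using rs True F.bump_trans P by blast
      moreover have "F.pos s \<longleftrightarrow> F.pos r" using pos_cong rs P by blast
      moreover have "gleq g h \<Longrightarrow> gleq h i \<Longrightarrow> gleq g i" "gleq i h \<Longrightarrow> gleq h g \<Longrightarrow> gleq i g"
        using linord_trans[OF gleq_linord] G by blast+
      moreover have "gleq g h \<Longrightarrow> gleq h g \<Longrightarrow> g = h" 
        using linord_antisym[OF gleq_linord] G by blast
      ultimately show ?thesis using k' rs True leq_trans by (auto split: if_splits)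
    next
      case False
      then have "\<not> F.bump r t" "leq r t \<longleftrightarrow> leq s t"
        using rs F.bump_left_cong[OF P] F.bump_trans F.bump_sym P by blast+
      then show ?thesis using k' False by auto
    qed
  next
    case rs: False
    show ?thesis
    proof (cases "F.bump s t")
      case True
      have ts: "F.bump t s" using True F.bump_sym P by blast
      then have "\<not> F.bump r t" using rs F.bump_trans P by blast
      moreover have "\<not> F.bump s r" using rs F.bump_sym P by blast
      then have "leq r t \<longleftrightarrow> leq r s" using F.bump_right_cong[OF P(3,2,1) ts] by blast
      ultimately show ?thesis using k' rs by auto
    next
      case False
      then have "leq r s" "leq s t" using k' rs by auto
      \<comment> \<open>Otherwise \<open>s\<close>, lying between \<open>r\<close> and
        \<open>t\<close>, would belong to their common bump by convexity.\<close>
      then have "\<not> F.bump r t" using F.bump_convex[OF P(1,3,2)] rs by blast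
      then show ?thesis using \<open>leq r s\<close> \<open>leq s t\<close> leq_trans by auto
    qed
  qed
  then show "key_leq a c" unfolding key_leq_def defs .
qed

lemma key_leq_mult:
  assumes "g \<in> carrier G" "a \<in> carrier G \<times> R" "b \<in> carrier G \<times> R" "key_leq a b"
  shows "key_leq (g \<otimes> fst a, snd a) (g \<otimes> fst b, snd b)"
  using assms gleq_mult[of g "fst a" "fst b"] gleq_mult[of g "fst b" "fst a"]
  unfolding key_leq_def by (auto split: if_splits)

text \<open>For \<open>y = g r\<close> the relation \<open>g r \<le> x\<close> is read as
  \<open>r \<le> inv g x\<close>, a comparison inside \<open>X\<close>, since \<open>G\<close>
  already acts on \<open>X'\<close>.\<close>

definition D :: "'x \<Rightarrow> 'x \<Rightarrow> bool" where
  "D y x \<longleftrightarrow> leq (snd (dec y)) (\<beta> (inv (fst (dec y))) x)"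

abbreviation "leq2 y y' \<equiv> key_leq (dec y) (dec y')"

definition leqY :: "'x \<Rightarrow> 'x \<Rightarrow> bool" where
  "leqY = cut_merge X' leq D leq2"

definition \<alpha> :: "'g \<Rightarrow> 'x \<Rightarrow> 'x" where
  "\<alpha> g y = (if y \<in> X' then \<beta> g y else j (g \<otimes> fst (dec y)) (snd (dec y)))"

lemma D_j: "g \<in> carrier G \<Longrightarrow> r \<in> R \<Longrightarrow> D (j g r) x \<longleftrightarrow> leq r (\<beta> (inv g) x)"
  unfolding D_def by (simp add: dec_j)

lemma \<alpha>_X': "x \<in> X' \<Longrightarrow> \<alpha> g x = \<beta> g x"
  unfolding \<alpha>_def by simp

lemma \<alpha>_j: "h \<in> carrier G \<Longrightarrow> r \<in> R \<Longrightarrow> \<alpha> g (j h r) = j (g \<otimes> h) r"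
  unfolding \<alpha>_def by (simp add: dec_j j_not_X')

lemma leqY_linord: "linord (X' \<union> N) leqY"
  unfolding leqY_def
proof (rule linord_cut_merge)
  show "linord X' leq" using linord_subset[OF X.lin X'X] .
  show "linord N leq2"
  proof (rule linord_image[OF key_leq_linord])
    show "dec y \<in> carrier G \<times> R" if "y \<in> N" for y
      using that by (auto elim!: N_cases simp: dec_j)
    show "inj_on dec N"
      by (rule inj_onI) (auto elim!: N_cases simp: dec_j)
  qed
  show "D y x'" if y: "y \<in> N" and "x \<in> X'" "x' \<in> X'" "D y x" "leq x x'" for y x x'
  proof -
    obtain g r where gr: "g \<in> carrier G" "r \<in> R" "y = j g r" using y by (rule N_cases)
    have "leq (\<beta> (inv g) x) (\<beta> (inv g) x')"
      using ordered_action_mono[OF \<beta>] that gr by simp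
    moreover have "\<beta> (inv g) x \<in> X" "\<beta> (inv g) x' \<in> X"
      using ordered_action_closed[OF \<beta>] that gr X'X by auto
    ultimately show ?thesis using that(4) gr D_j linord_trans[OF X.lin] R_X by blast
  qed
qed (rule N_X')

text \<open>The coordinate \<open>h\<close> of \<open>y\<close> becomes \<open>g h\<close>, and
  \<open>inv (g h)\<close> applied to \<open>g x\<close> is \<open>inv h\<close> applied to
  \<open>x\<close>. Hence \<open>G\<close> permutes the cuts.\<close>

lemma D_\<alpha>:
  assumes "g \<in> carrier G" "y \<in> N" "x \<in> X'"
  shows "D (\<alpha> g y) (\<beta> g x) \<longleftrightarrow> D y x"
proof -
  obtain h r where hr: "h \<in> carrier G" "r \<in> R" "y = j h r" using assms(2) by (rule N_cases)
  have "\<beta> (inv (g \<otimes> h)) (\<beta> g x) = \<beta> (inv h) x"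
    using assms hr ordered_action_mult[OF \<beta>, of "inv h" "inv g" "\<beta> g x"]
      ordered_action_closed[OF \<beta>, of g x] ordered_action_inv(1)[OF \<beta>, of g x]
    by (simp add: inv_mult_group)
  then show ?thesis using hr assms by (simp add: \<alpha>_j D_j)
qed

lemma \<alpha>_action: "ordered_action G (X' \<union> N) leqY \<alpha>"
  unfolding ordered_action_def
proof (intro conjI ballI impI)
  have N_closed: "\<alpha> g y \<in> N" if "g \<in> carrier G" "y \<in> N" for g y
    using that by (auto elim!: N_cases simp: \<alpha>_j intro!: j_N)
  have X'_closed: "\<alpha> g y \<in> X'" if "g \<in> carrier G" "y \<in> X'" for g y
    using that ordered_action_closed[OF \<beta>] by (simp add: \<alpha>_X')
  {
    fix g y assume "g \<in> carrier G" "y \<in> X' \<union> N"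
    then show "\<alpha> g y \<in> X' \<union> N" using N_closed X'_closed by blast
  next
    fix y assume "y \<in> X' \<union> N"
    then show "\<alpha> \<one> y = y"
      by (auto elim!: N_cases simp: \<alpha>_j \<alpha>_X' ordered_action_one[OF \<beta>])
  next
    fix g h y assume gh: "g \<in> carrier G" "h \<in> carrier G" and y: "y \<in> X' \<union> N"
    show "\<alpha> (g \<otimes> h) y = \<alpha> g (\<alpha> h y)"
    proof (cases "y \<in> X'")
      case True
      then show ?thesis using gh X'_closed[of h y] ordered_action_mult[OF \<beta>] by (simp add: \<alpha>_X')
    next
      case False
      then show ?thesis using y gh by (auto elim!: N_cases simp: \<alpha>_j m_assoc)
    qed
  next
    fix g y assume g: "g \<in> carrier G" and y: "y \<in> X' \<union> N" and fixed: "\<alpha> g y = y"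
    show "g = \<one>"
    proof (cases "y \<in> X'")
      case True
      then show ?thesis using fixed g ordered_action_free[OF \<beta>] by (simp add: \<alpha>_X')
    next
      case False
      then obtain h r where hr: "h \<in> carrier G" "r \<in> R" "y = j h r" using y by (auto elim: N_cases)
      then have "g \<otimes> h = h" using fixed g j_inj[of "g \<otimes> h" h r r] by (simp add: \<alpha>_j)
      then show ?thesis using g hr right_cancel[of h g \<one>] by simp
    qed
  next
    fix g x y assume g: "g \<in> carrier G" and xy: "x \<in> X' \<union> N" "y \<in> X' \<union> N" and le: "leqY x y"
    have nX: "w \<notin> X'" if "w \<in> N" for w using that N_X' by blast
    show "leqY (\<alpha> g x) (\<alpha> g y)"
    proof (cases "x \<in> X'")
      case x: True
      show ?thesis
      proof (cases "y \<in> X'")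
        case True
        then show ?thesis using x le X'_closed[OF g] ordered_action_mono[OF \<beta> g]
          unfolding leqY_def cut_merge_def by (auto simp: \<alpha>_X')
      next
        case False
        then have "y \<in> N" using xy by blast
        then show ?thesis using x False le X'_closed[OF g x] nX[OF N_closed[OF g]] D_\<alpha>[OF g, of y x]
          unfolding leqY_def cut_merge_def by (auto simp: \<alpha>_X'[OF x])
      qed
    next
      case x: False
      then have xN: "x \<in> N" using xy by blast
      show ?thesis
      proof (cases "y \<in> X'")
        case True
        then show ?thesis using x xN le X'_closed[OF g True] nX[OF N_closed[OF g]] D_\<alpha>[OF g, of x y]
          unfolding leqY_def cut_merge_def by (auto simp: \<alpha>_X'[OF True])
      next
        case y: False
        then have yN: "y \<in> N" using xy by blast
        \<comment> \<open>Equality of cuts quantifies over all of \<open>X'\<close>; every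
          \<open>v\<close> is the translate by \<open>g\<close> of the point
          \<open>inv g v\<close>.\<close>
        have D_back: "D (\<alpha> g w) v \<longleftrightarrow> D w (\<beta> (inv g) v)" if "w \<in> N" "v \<in> X'" for w v
          using D_\<alpha>[OF g that(1), of "\<beta> (inv g) v"] ordered_action_inv(2)[OF \<beta> g that(2)]
            ordered_action_closed[OF \<beta>, of "inv g" v] g that by simp
        have "(\<exists>v\<in>X'. D x v \<and> \<not> D y v) \<or> (\<forall>v\<in>X'. D x v \<longleftrightarrow> D y v) \<and> leq2 x y"
          using le x y unfolding leqY_def cut_merge_def by simp
        then have "(\<exists>v\<in>X'. D (\<alpha> g x) v \<and> \<not> D (\<alpha> g y) v) \<or>
            (\<forall>v\<in>X'. D (\<alpha> g x) v \<longleftrightarrow> D (\<alpha> g y) v) \<and> leq2 (\<alpha> g x) (\<alpha> g y)"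
        proof
          assume "\<exists>v\<in>X'. D x v \<and> \<not> D y v"
          then obtain v where v: "v \<in> X'" "D x v" "\<not> D y v" by blast
          then have "\<beta> g v \<in> X'" "D (\<alpha> g x) (\<beta> g v)" "\<not> D (\<alpha> g y) (\<beta> g v)"
            using D_\<alpha>[OF g] xN yN ordered_action_closed[OF \<beta> g] by auto
          then show ?thesis by blast
        next
          assume a: "(\<forall>v\<in>X'. D x v \<longleftrightarrow> D y v) \<and> leq2 x y"
          have "D (\<alpha> g x) v \<longleftrightarrow> D (\<alpha> g y) v" if "v \<in> X'" for v
            using a D_back xN yN that ordered_action_closed[OF \<beta>, of "inv g" v] g by simp
          moreover have "leq2 (\<alpha> g x) (\<alpha> g y)"
          proof -
            obtain h r where hr: "h \<in> carrier G" "r \<in> R" "x = j h r" using xN by (rule N_cases)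
            obtain i s where is': "i \<in> carrier G" "s \<in> R" "y = j i s" using yN by (rule N_cases)
            show ?thesis using key_leq_mult[OF g, of "(h, r)" "(i, s)"] a hr is' g
              by (simp add: \<alpha>_j dec_j)
          qed
          ultimately show ?thesis by blast
        qed
        then show ?thesis using nX[OF N_closed[OF g xN]] nX[OF N_closed[OF g yN]]
          unfolding leqY_def cut_merge_def by simp
      qed
    qed
  }
qed

text \<open>For an old point, \<open>dec p\<close> has a power of \<open>z\<close> as group entry.
  It acts on \<open>X'\<close> as the flow does, so undoing the shift restores the comparison in
  \<open>X\<close>.\<close>

lemma D_P:
  assumes "p \<in> P" "x \<in> X'" shows "D p x \<longleftrightarrow> leq p x"
proof -
  have "\<beta> (inv (z [^] f p)) x = S (- f p) x"
    using \<beta>_z[OF assms(2), of "- f p"] z by (simp add: int_pow_neg)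
  then have "D p x \<longleftrightarrow> leq (S (- f p) p) (S (- f p) x)"
    using dec_P[OF assms(1)] unfolding D_def base_def by simp
  also have "\<dots> \<longleftrightarrow> leq p x" using X.S_le_iff assms X'X by blast
  finally show ?thesis .
qed

text \<open>Points of \<open>P\<close> in different bumps compare like their base points. Within a
  bump the heights decide, and \<open>z \<ge> \<one>\<close> turns an inequality of heights into one
  of powers of \<open>z\<close>; for equal powers both points are shifted by the same map.\<close>

lemma leq2_P:
  assumes "p \<in> P" "q \<in> P" shows "leq2 p q \<longleftrightarrow> leq p q"
proof -
  \<comment> \<open>One implication suffices, both relations being linear orders and
    \<open>dec\<close> being injective on \<open>P\<close>.\<close>
  have imp: "leq2 p q" if "leq p q" "p \<in> P" "q \<in> P" for p q
  proof -
    have bp: "F.bump p (base p)" "F.bump q (base q)" "F.bump (base p) p" "F.bump (base q) q"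
      using F.bump_S F.bump_sym S_P that unfolding base_def by auto
    have B: "base p \<in> P" "base q \<in> P" using base_R R_P that by blast+
    have bump_iff: "F.bump (base p) (base q) \<longleftrightarrow> F.bump p q"
      using bp B that(2,3) F.bump_trans by blast
    have pos_p: "F.pos (base p) \<longleftrightarrow> F.pos p" using pos_cong bp B that by blast
    show ?thesis
    proof (cases "F.bump p q")
      case False
      have "leq (base p) q" using F.bump_left_cong[OF B(1) that(2,3) bp(3) False] that by blast
      moreover have "\<not> F.bump (base p) q" using False bp B that F.bump_trans by blast
      then have "\<not> F.bump q (base p)" using F.bump_sym B that by blast
      ultimately have "leq (base p) (base q)"
        using F.bump_right_cong[OF B(2) that(3) B(1) bp(4)] by blast
      then show ?thesis using False bump_iff that unfolding key_leq_def by (simp add: dec_P)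
    next
      case True
      show ?thesis
      proof (cases "z [^] f p = z [^] f q")
        case eq: True
        then have "S (- f q) p = S (- f p) p"
          using S_eq_iff[of p "- f q" "- f p"] that z by (simp add: int_pow_neg)
        then have "leq (base p) (base q)"
          using that X.S_mono[of p q "- f q"] unfolding base_def by auto
        then show ?thesis using eq that unfolding key_leq_def by (simp add: dec_P)
      next
        case False
        then have "f p \<noteq> f q" by auto
        have "p \<noteq> q" using False by auto
        then have nle: "\<not> leq q p" using that linord_antisym[OF F.lin] by blast
        have "F.bump q p" using True F.bump_sym that by blast
        \<comment> \<open>The opposite inequality of heights would give \<open>leq q p\<close> by
          \<open>f_less\<close>.\<close>
        then have "if F.pos p then f p < f q else f q < f p"
          using f_less[OF that(2,3) True] f_less[OF that(3,2)] nle \<open>f p \<noteq> f q\<close> pos_cong[OF that(2,3) True]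
          by (auto split: if_splits) (metis linorder_neqE)+
        then have "if F.pos p then gleq (z [^] f p) (z [^] f q) else gleq (z [^] f q) (z [^] f p)"
          using left_order_pow_mono[OF gord z] by auto
        then show ?thesis using True False bump_iff pos_p that unfolding key_leq_def by (auto simp: dec_P)
      qed
    qed
  qed
  show ?thesis
  proof
    assume a: "leq2 p q"
    show "leq p q"
    proof (rule ccontr)
      assume n: "\<not> leq p q"
      then have "leq q p" using linord_total[OF F.lin] assms by blast
      then have "leq2 q p" using imp assms by blast
      moreover have "dec p \<in> carrier G \<times> R" "dec q \<in> carrier G \<times> R"
        using assms z base_R by (auto simp: dec_P)
      ultimately have "dec p = dec q" using a linord_antisym[OF key_leq_linord] by metis
      then have "p = q" using P_j[of p] P_j[of q] assms by (metis dec_P Pair_inject)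
      then show False using n linord_refl[OF F.lin] assms by blast
    qed
  qed (use imp assms in blast)
qed

text \<open>On \<open>P\<close> the cuts are those given by \<open>leq\<close>. A point
  \<open>v\<close> of \<open>X'\<close> that separates the cuts of \<open>x\<close> and
  \<open>y\<close> satisfies \<open>x \<le> v < y\<close>, so comparing cuts first is consistent
  with \<open>leq\<close>.\<close>

lemma leqY_X:
  assumes "x \<in> X" "y \<in> X" shows "leqY x y \<longleftrightarrow> leq x y"
proof (cases "x \<in> X'")
  case x: True
  show ?thesis
  proof (cases "y \<in> X'")
    case True
    then show ?thesis using x unfolding leqY_def cut_merge_def by simp
  next
    case False
    then have "x \<noteq> y" using x by auto
    then have "leq x y \<longleftrightarrow> \<not> leq y x"
      using linord_total[OF X.lin assms] linord_antisym[OF X.lin] assms by blast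
    then show ?thesis using x False assms D_P unfolding leqY_def cut_merge_def by simp
  qed
next
  case x: False
  then have xP: "x \<in> P" using assms by simp
  show ?thesis
  proof (cases "y \<in> X'")
    case True
    then show ?thesis using x xP D_P unfolding leqY_def cut_merge_def by simp
  next
    case False
    then have yP: "y \<in> P" using assms by simp
    have "leqY x y \<longleftrightarrow> (\<exists>v\<in>X'. leq x v \<and> \<not> leq y v) \<or> (\<forall>v\<in>X'. leq x v \<longleftrightarrow> leq y v) \<and> leq x y"
      using x False D_P xP yP leq2_P[OF xP yP] unfolding leqY_def cut_merge_def by simp
    also have "\<dots> \<longleftrightarrow> leq x y"
    proof
      assume "(\<exists>v\<in>X'. leq x v \<and> \<not> leq y v) \<or> (\<forall>v\<in>X'. leq x v \<longleftrightarrow> leq y v) \<and> leq x y"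
      then show "leq x y"
      proof
        assume "\<exists>v\<in>X'. leq x v \<and> \<not> leq y v"
        then obtain v where v: "v \<in> X" "leq x v" "\<not> leq y v" using X'X by blast
        then have "leq v y" using linord_total[OF X.lin] assms by blast
        then show ?thesis using v linord_trans[OF X.lin] assms by blast
      qed simp
    next
      assume xy: "leq x y"
      have "leq x v" if "v \<in> X'" "leq y v" for v
        using linord_trans[OF X.lin xy that(2)] assms that X'X by blast
      then show "(\<exists>v\<in>X'. leq x v \<and> \<not> leq y v) \<or> (\<forall>v\<in>X'. leq x v \<longleftrightarrow> leq y v) \<and> leq x y"
        using xy by blast
    qed
    finally show ?thesis .
  qed
qed

text \<open>Multiplying the coordinate \<open>z [^] f x\<close> by \<open>z [^] k\<close> adds
  \<open>k\<close> to the exponent, which is the effect of \<open>S k\<close>. Thus both groups keep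
  acting alike on the amalgamated subgroup.\<close>

lemma \<alpha>_z:
  assumes "x \<in> X" shows "\<alpha> (z [^] (k::int)) x = S k x"
proof (cases "x \<in> X'")
  case True
  then show ?thesis by (simp add: \<alpha>_X' \<beta>_z)
next
  case False
  then have p: "x \<in> P" using assms by simp
  have "\<alpha> (z [^] k) x = j (z [^] k \<otimes> z [^] f x) (base x)"
    using \<alpha>_j[of "z [^] f x" "base x" "z [^] k"] P_j[OF p] base_R[OF p] z by simp
  also have "\<dots> = S (k + f x) (base x)"
    using j_pow[OF R_X[OF base_R[OF p]], of "k + f x"] z by (simp add: int_pow_mult)
  also have "\<dots> = S k x"
    using X.S_add[OF R_X[OF base_R[OF p]]] S_base[OF p] by simp
  finally show ?thesis .
qed

section \<open>Equivariance of \<open>\<rho>\<close> and the resulting extension\<close>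

lemma \<rho>_j:
  assumes "g \<in> carrier G" "r \<in> R" shows "\<rho> (j g r) = L g (\<rho> r)"
proof (cases g rule: j_cases)
  case (pow m)
  then show ?thesis using assms R_X \<rho>_S by simp
next
  case new
  then show ?thesis using assms R_P \<rho>_new by simp
qed

lemma \<rho>_closed:
  assumes "y \<in> X' \<union> N" shows "\<rho> y \<in> W"
  using assms \<rho>_W X'X by (auto elim!: N_cases simp: \<rho>_j R_X intro!: L_closed)

lemma \<rho>_\<alpha>:
  assumes "g \<in> carrier G" "y \<in> X' \<union> N" shows "\<rho> (\<alpha> g y) = L g (\<rho> y)"
proof (cases "y \<in> X'")
  case True
  then show ?thesis using \<rho>_\<beta> assms by (simp add: \<alpha>_X')
next
  case False
  then obtain h r where "h \<in> carrier G" "r \<in> R" "y = j h r" using assms by (auto elim: N_cases)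
  then show ?thesis using assms(1) \<rho>_W R_X by (simp add: \<alpha>_j \<rho>_j L_mult)
qed

lemma X'_N_subset: "X' \<union> N \<subseteq> X \<union> {new g p | g p. g \<in> carrier G \<and> p \<in> P}"
proof
  fix y assume "y \<in> X' \<union> N"
  then consider "y \<in> X" | g r where "g \<in> carrier G" "r \<in> R" "y = j g r"
    using X'X by (auto elim: N_cases)
  then show "y \<in> X \<union> {new g p | g p. g \<in> carrier G \<and> p \<in> P}"
  proof cases
    case (2 g r)
    then show ?thesis using R_P[OF 2(2)] R_X[OF 2(2)] X.S_closed by (cases g rule: j_cases) auto
  qed simp
qed

text \<open>The upper bound on \<open>Y\<close> records which names were used, so that fresh ones
  can be found for the following extension.\<close>

theorem extension_exists:
  "\<exists>Y leq' \<alpha>. X \<subseteq> Y \<and> Y \<subseteq> X \<union> {new g p | g p. g \<in> carrier G \<and> p \<in> P} \<and> linord Y leq' \<and>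
     (\<forall>x\<in>X. \<forall>y\<in>X. leq' x y \<longleftrightarrow> leq x y) \<and> ordered_action G Y leq' \<alpha> \<and>
     (\<forall>g\<in>carrier G. \<forall>x\<in>X'. \<alpha> g x = \<beta> g x) \<and> (\<forall>k::int. \<forall>x\<in>X. \<alpha> (z [^] k) x = S k x) \<and>
     (\<forall>y\<in>Y. \<rho> y \<in> W) \<and> (\<forall>g\<in>carrier G. \<forall>y\<in>Y. \<rho> (\<alpha> g y) = L g (\<rho> y))"
proof -
  have "X \<subseteq> X' \<union> N" using P_N by blast
  then show ?thesis
    using X'_N_subset leqY_linord leqY_X \<alpha>_action \<alpha>_X' \<alpha>_z \<rho>_closed \<rho>_\<alpha>
    by (intro exI[of _ "X' \<union> N"] exI[of _ leqY] exI[of _ \<alpha>]) simp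
qed

end

section \<open>The tower\<close>

type_synonym ('g, 'h) tower = "('g + 'h) list set \<times> ('g + 'h) list set \<times>
  (('g + 'h) list \<Rightarrow> ('g + 'h) list \<Rightarrow> bool) \<times> ('g \<Rightarrow> ('g + 'h) list \<Rightarrow> ('g + 'h) list) \<times>
  ('h \<Rightarrow> ('g + 'h) list \<Rightarrow> ('g + 'h) list)"

text \<open>The group \<open>A\<close> is the one lagging behind, acting on \<open>X'\<close> only,
  while \<open>B\<close> acts on all of \<open>X\<close>. The groups are parameters because their
  roles are exchanged at each extension.\<close>

definition stage where
  "stage A B zA zB LA LB W \<rho> X' X leq \<beta> \<alpha> \<longleftrightarrow>
     X' \<subseteq> X \<and> linord X leq \<and> ordered_action A X' leq \<beta> \<and> ordered_action B X leq \<alpha> \<and>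
     (\<forall>k::int. \<forall>x\<in>X'. \<beta> (zA [^]\<^bsub>A\<^esub> k) x = \<alpha> (zB [^]\<^bsub>B\<^esub> k) x) \<and>
     (\<forall>x\<in>X. \<rho> x \<in> W) \<and>
     (\<forall>g\<in>carrier A. \<forall>x\<in>X'. \<rho> (\<beta> g x) = LA g (\<rho> x)) \<and>
     (\<forall>h\<in>carrier B. \<forall>x\<in>X. \<rho> (\<alpha> h x) = LB h (\<rho> x))"

lemma ordered_action_cong:
  assumes "ordered_action G X leq act" "\<And>x y. x \<in> X \<Longrightarrow> y \<in> X \<Longrightarrow> leq' x y = leq x y"
    "\<And>g x. g \<in> carrier G \<Longrightarrow> x \<in> X \<Longrightarrow> act' g x = act g x" "group G"
  shows "ordered_action G X leq' act'"
proof -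
  interpret group G by fact
  show ?thesis
    using ordered_actionD[OF assms(1)] assms(2,3) unfolding ordered_action_def by simp
qed

text \<open>The extension theorem with the flow given by powers of \<open>zB\<close> on
  \<open>X\<close>. Afterwards \<open>A\<close> acts on the larger set and \<open>B\<close> lags
  behind.\<close>

lemma stage_extend:
  assumes A: "group A" and B: "group B" and ord: "left_order A r"
    and zA: "zA \<in> carrier A" "r \<one>\<^bsub>A\<^esub> zA" and zB: "zB \<in> carrier B"
    and z_iff: "\<And>k::int. zA [^]\<^bsub>A\<^esub> k = \<one>\<^bsub>A\<^esub> \<longleftrightarrow> zB [^]\<^bsub>B\<^esub> k = \<one>\<^bsub>B\<^esub>"
    and LA_closed: "\<And>g w. g \<in> carrier A \<Longrightarrow> w \<in> W \<Longrightarrow> LA g w \<in> W"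
    and LA_mult: "\<And>g h w. g \<in> carrier A \<Longrightarrow> h \<in> carrier A \<Longrightarrow> w \<in> W \<Longrightarrow> LA (g \<otimes>\<^bsub>A\<^esub> h) w = LA g (LA h w)"
    and LA_LB: "\<And>k w. w \<in> W \<Longrightarrow> LA (zA [^]\<^bsub>A\<^esub> (k::int)) w = LB (zB [^]\<^bsub>B\<^esub> k) w"
    and st: "stage A B zA zB LA LB W \<rho> X' X leq \<beta> \<alpha>"
    and new_inj: "\<And>g h p q. new g p = new h q \<Longrightarrow> g = h \<and> p = q"
    and new_fresh: "\<And>g p. g \<in> carrier A \<Longrightarrow> p \<in> X - X' \<Longrightarrow> new g p \<notin> X"
    and \<rho>_new: "\<And>g p. g \<in> carrier A \<Longrightarrow> p \<in> X \<Longrightarrow> \<rho> (new g p) = LA g (\<rho> p)"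
  obtains Y leq' \<beta>' where
    "stage B A zB zA LB LA W \<rho> X Y leq' \<alpha> \<beta>'"
    "Y \<subseteq> X \<union> {new g p | g p. g \<in> carrier A \<and> p \<in> X - X'}"
    "\<And>x y. x \<in> X \<Longrightarrow> y \<in> X \<Longrightarrow> leq' x y = leq x y"
    "\<And>g x. g \<in> carrier A \<Longrightarrow> x \<in> X' \<Longrightarrow> \<beta>' g x = \<beta> g x"
proof -
  interpret A: group A by (rule A)
  interpret B: group B by (rule B)
  have X'X: "X' \<subseteq> X" and lin: "linord X leq" and \<beta>: "ordered_action A X' leq \<beta>"
    and \<alpha>: "ordered_action B X leq \<alpha>"
    and z: "\<And>k x. x \<in> X' \<Longrightarrow> \<beta> (zA [^]\<^bsub>A\<^esub> (k::int)) x = \<alpha> (zB [^]\<^bsub>B\<^esub> k) x"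
    and \<rho>: "\<And>x. x \<in> X \<Longrightarrow> \<rho> x \<in> W" "\<And>g x. g \<in> carrier A \<Longrightarrow> x \<in> X' \<Longrightarrow> \<rho> (\<beta> g x) = LA g (\<rho> x)"
      "\<And>h x. h \<in> carrier B \<Longrightarrow> x \<in> X \<Longrightarrow> \<rho> (\<alpha> h x) = LB h (\<rho> x)"
    using st unfolding stage_def by auto
  define S where "S k = \<alpha> (zB [^]\<^bsub>B\<^esub> (k::int))" for k
  have flow: "int_flow X leq S"
  proof
    show "S (k + l) x = S k (S l x)" if "x \<in> X" for k l x
      using ordered_action_mult[OF \<alpha>, of "zB [^]\<^bsub>B\<^esub> k" "zB [^]\<^bsub>B\<^esub> l" x] that zB
      unfolding S_def by (simp add: B.int_pow_mult)
  qed (use lin ordered_action_closed[OF \<alpha>] ordered_action_one[OF \<alpha>] ordered_action_mono[OF \<alpha>] zB in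
      \<open>auto simp: S_def\<close>)
  interpret amalgam_step A r zA X' X leq \<beta> S new LA W \<rho>
  proof
    show "S k x = x \<longleftrightarrow> zA [^]\<^bsub>A\<^esub> k = \<one>\<^bsub>A\<^esub>" if "x \<in> X" for x k
      using that ordered_action_free[OF \<alpha>, of "zB [^]\<^bsub>B\<^esub> k" x] ordered_action_one[OF \<alpha>] zB z_iff
      unfolding S_def by auto
    show "\<rho> (S k x) = LA (zA [^]\<^bsub>A\<^esub> k) (\<rho> x)" if "x \<in> X" for k x
      using \<rho> that zB LA_LB unfolding S_def by simp
    show "\<beta> (zA [^]\<^bsub>A\<^esub> k) x = S k x" if "x \<in> X'" for x k
      using z that unfolding S_def by simp
    show "g = h \<and> p = q" if "new g p = new h q" for g h p q using new_inj that by blast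
  qed (use ord zA X'X \<beta> flow[unfolded int_flow_def] new_fresh LA_closed LA_mult \<rho> \<rho>_new in auto)
  obtain Y leq' \<beta>' where Y: "X \<subseteq> Y" "Y \<subseteq> X \<union> {new g p | g p. g \<in> carrier A \<and> p \<in> X - X'}"
    "linord Y leq'" "\<forall>x\<in>X. \<forall>y\<in>X. leq' x y \<longleftrightarrow> leq x y" "ordered_action A Y leq' \<beta>'"
    "\<forall>g\<in>carrier A. \<forall>x\<in>X'. \<beta>' g x = \<beta> g x" "\<forall>k::int. \<forall>x\<in>X. \<beta>' (zA [^]\<^bsub>A\<^esub> k) x = S k x"
    "\<forall>y\<in>Y. \<rho> y \<in> W" "\<forall>g\<in>carrier A. \<forall>y\<in>Y. \<rho> (\<beta>' g y) = LA g (\<rho> y)"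
    using extension_exists by blast
  have "ordered_action B X leq' \<alpha>"
    by (rule ordered_action_cong[OF \<alpha> _ _ B]) (use Y(4) in auto)
  then have "stage B A zB zA LB LA W \<rho> X Y leq' \<alpha> \<beta>'"
    using Y \<rho>(3) unfolding stage_def S_def by simp
  then show ?thesis by (rule that[of Y leq' \<beta>']) (use Y in auto)
qed

text \<open>The value at \<open>k\<close> is taken from the first stage containing \<open>k\<close>;
  compatibility carries it to all later ones.\<close>

lemma chain_limit:
  assumes mono: "\<And>n k. k \<in> K n \<Longrightarrow> k \<in> K (Suc n)" and eq: "\<And>n k. k \<in> K n \<Longrightarrow> F (Suc n) k = F n k"
  obtains L where "\<And>n k. k \<in> K n \<Longrightarrow> L k = F n k"
proof -
  have up: "k \<in> K (n + d) \<and> F (n + d) k = F n k" if "k \<in> K n" for k n d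
    using that by (induction d) (auto simp: mono eq)
  have "F (LEAST n. k \<in> K n) k = F n k" if k: "k \<in> K n" for n k
  proof -
    let ?m = "LEAST n. k \<in> K n"
    have "k \<in> K ?m" "?m \<le> n" using k by (auto intro: LeastI Least_le)
    then show ?thesis using up[of k ?m "n - ?m"] by simp
  qed
  then show ?thesis using that[of "\<lambda>k. F (LEAST n. k \<in> K n) k"] by blast
qed

lemma left_order_positive:
  assumes "group G" "left_order G r" "z \<in> carrier G"
  obtains r' where "left_order G r'" "r' \<one>\<^bsub>G\<^esub> z"
proof (cases "r \<one>\<^bsub>G\<^esub> z")
  case False
  interpret group G by fact
  have lin: "linord (carrier G) r" using assms(2) unfolding left_order_iff by blast
  have "left_order G (\<lambda>x y. r y x)"
    using assms(2) linord_converse[OF lin] unfolding left_order_iff by simp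
  moreover have "r z \<one>\<^bsub>G\<^esub>" using False linord_total[OF lin, of z "\<one>\<^bsub>G\<^esub>"] assms(3) by auto
  ultimately show ?thesis using that by blast
qed (use assms that in blast)

text \<open>The orders make the images of the generator \<open>c\<close> nonnegative on both sides,
  as required when either group takes the role of \<open>A\<close> in
  \<open>stage_extend\<close>.\<close>

locale cyclic_amalgam = G: group G + H: group H + C: group C
  for G :: "'g monoid" and H :: "'h monoid" and C :: "'c monoid" +
  fixes \<phi> :: "'c \<Rightarrow> 'g" and \<psi> :: "'c \<Rightarrow> 'h" and c :: 'c
    and gleq :: "'g \<Rightarrow> 'g \<Rightarrow> bool" and hleq :: "'h \<Rightarrow> 'h \<Rightarrow> bool"
  assumes \<phi>: "\<phi> \<in> hom C G" "inj_on \<phi> (carrier C)" and \<psi>: "\<psi> \<in> hom C H" "inj_on \<psi> (carrier C)"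
    and c: "c \<in> carrier C" "carrier C = range (\<lambda>n::int. c [^]\<^bsub>C\<^esub> n)"
    and gleq: "left_order G gleq" "gleq \<one>\<^bsub>G\<^esub> (\<phi> c)" and hleq: "left_order H hleq" "hleq \<one>\<^bsub>H\<^esub> (\<psi> c)"
begin

section \<open>Words and their classes in the amalgam\<close>

abbreviation "rel \<equiv> amal_rel G H C \<phi> \<psi>"

abbreviation "words \<equiv> amal_words G H"

lemma \<phi>_closed: "x \<in> carrier C \<Longrightarrow> \<phi> x \<in> carrier G" and \<psi>_closed: "x \<in> carrier C \<Longrightarrow> \<psi> x \<in> carrier H"
  using \<phi> \<psi> by (auto simp: hom_def)

lemma words_Nil [simp]: "[] \<in> words"
  and words_Inl [simp]: "Inl g # w \<in> words \<longleftrightarrow> g \<in> carrier G \<and> w \<in> words"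
  and words_Inr [simp]: "Inr h # w \<in> words \<longleftrightarrow> h \<in> carrier H \<and> w \<in> words"
  and words_append [simp]: "u @ v \<in> words \<longleftrightarrow> u \<in> words \<and> v \<in> words"
  unfolding amal_words_def by (simp_all add: image_iff)

lemma rel_words: "rel u v \<Longrightarrow> u \<in> words \<and> v \<in> words"
  by (induction rule: amal_rel.induct) (auto simp: \<phi>_closed \<psi>_closed)

lemma rel_append_left: "rel u v \<Longrightarrow> a \<in> words \<Longrightarrow> rel (a @ u) (a @ v)"
  using amal_rel.cong[of G H C \<phi> \<psi> u v a "[]"] by simp

lemma rel_append_right: "rel u v \<Longrightarrow> b \<in> words \<Longrightarrow> rel (u @ b) (v @ b)"
  using amal_rel.cong[of G H C \<phi> \<psi> u v "[]" b] by simp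

lemma rel_append: "rel u v \<Longrightarrow> rel u' v' \<Longrightarrow> rel (u @ u') (v @ v')"
  using rel_append_right[of u v u'] rel_append_left[of u' v' v] rel_words[of u v] rel_words[of u' v']
  by (blast intro: amal_rel.trans)

definition cls :: "('g + 'h) list \<Rightarrow> ('g + 'h) list set" where
  "cls w = {v. rel w v}"

text \<open>Left multiplication by the class of a letter; it serves as the map \<open>L\<close> in
  the extension step, with \<open>cls\<close> as \<open>\<rho>\<close>.\<close>

definition left_mult :: "'g + 'h \<Rightarrow> ('g + 'h) list set \<Rightarrow> ('g + 'h) list set" where
  "left_mult s A = {w. \<exists>a\<in>A. rel (s # a) w}"

lemma cls_eq_iff: "u \<in> words \<Longrightarrow> cls u = cls v \<longleftrightarrow> rel u v"
  unfolding cls_def using amal_rel.refl amal_rel.sym amal_rel.trans by (metis (no_types, lifting) Collect_cong mem_Collect_eq rel_words)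

lemma left_mult_cls:
  assumes "s # w \<in> words" shows "left_mult s (cls w) = cls (s # w)"
proof -
  have s: "[s] \<in> words" and w: "w \<in> words" using assms words_append[of "[s]" w] by auto
  have "rel (s # w) (s # a)" if "rel w a" for a
    using rel_append_left[OF that s] by simp
  then show ?thesis unfolding left_mult_def cls_def
    using amal_rel.refl[OF w] by (blast intro: amal_rel.trans amal_rel.sym)
qed

lemma pow_one_iff:
  "\<phi> c [^]\<^bsub>G\<^esub> (k::int) = \<one>\<^bsub>G\<^esub> \<longleftrightarrow> c [^]\<^bsub>C\<^esub> k = \<one>\<^bsub>C\<^esub>"
  "\<psi> c [^]\<^bsub>H\<^esub> (k::int) = \<one>\<^bsub>H\<^esub> \<longleftrightarrow> c [^]\<^bsub>C\<^esub> k = \<one>\<^bsub>C\<^esub>"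
proof -
  have "f c [^]\<^bsub>K\<^esub> k = \<one>\<^bsub>K\<^esub> \<longleftrightarrow> c [^]\<^bsub>C\<^esub> k = \<one>\<^bsub>C\<^esub>"
    if "f \<in> hom C K" "inj_on f (carrier C)" "group K" for f and K :: "'k monoid"
  proof -
    have "f c [^]\<^bsub>K\<^esub> k = f (c [^]\<^bsub>C\<^esub> k)"
      using hom_int_pow[OF that(1) c(1)] C.is_group that(3) by simp
    moreover have "f \<one>\<^bsub>C\<^esub> = \<one>\<^bsub>K\<^esub>" by (rule hom_one[OF that(1) C.is_group that(3)])
    ultimately show ?thesis using inj_on_eq_iff[OF that(2), of "c [^]\<^bsub>C\<^esub> k" "\<one>\<^bsub>C\<^esub>"] c(1) by auto
  qed
  then show "\<phi> c [^]\<^bsub>G\<^esub> k = \<one>\<^bsub>G\<^esub> \<longleftrightarrow> c [^]\<^bsub>C\<^esub> k = \<one>\<^bsub>C\<^esub>"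
    "\<psi> c [^]\<^bsub>H\<^esub> k = \<one>\<^bsub>H\<^esub> \<longleftrightarrow> c [^]\<^bsub>C\<^esub> k = \<one>\<^bsub>C\<^esub>"
    using \<phi> \<psi> G.is_group H.is_group by blast+
qed

lemma rel_pow: "rel [Inl (\<phi> c [^]\<^bsub>G\<^esub> (k::int))] [Inr (\<psi> c [^]\<^bsub>H\<^esub> k)]"
  using amal_rel.amalg[of "c [^]\<^bsub>C\<^esub> k" C G H \<phi> \<psi>] c(1)
    hom_int_pow[OF \<phi>(1) c(1) C.is_group G.is_group] hom_int_pow[OF \<psi>(1) c(1) C.is_group H.is_group]
  by simp

text \<open>Points are words, and a new point is named by prefixing a letter. The most recent points
  all have the maximal length \<open>n\<close>, so prefixing a letter to one of them leaves
  \<open>X\<close>. The word \<open>[Inr \<one>]\<close> will be the base point of the orbit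
  map.\<close>

definition tower_stage :: "nat \<Rightarrow> ('g, 'h) tower \<Rightarrow> bool" where
  "tower_stage n = (\<lambda>(X', X, leq, \<beta>, \<alpha>).
     stage G H (\<phi> c) (\<psi> c) (left_mult \<circ> Inl) (left_mult \<circ> Inr) (cls ` words) cls X' X leq \<beta> \<alpha> \<and>
     X \<subseteq> words \<and> (\<forall>x\<in>X. length x \<le> n) \<and> (\<forall>x\<in>X - X'. length x = n) \<and> [Inr \<one>\<^bsub>H\<^esub>] \<in> X)"

text \<open>The tower starts with \<open>H\<close> acting on itself by left multiplication, written
  as one-letter words, while \<open>G\<close> acts on the empty set.\<close>

lemma tower_start:
  "\<exists>s. tower_stage 1 s"
proof -
  define X :: "('g + 'h) list set" where "X = (\<lambda>h. [Inr h]) ` carrier H"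
  define leq :: "('g + 'h) list \<Rightarrow> ('g + 'h) list \<Rightarrow> bool"
    where "leq x y \<longleftrightarrow> hleq (projr (hd x)) (projr (hd y))" for x y
  define \<alpha> :: "'h \<Rightarrow> ('g + 'h) list \<Rightarrow> ('g + 'h) list"
    where "\<alpha> h x = [Inr (h \<otimes>\<^bsub>H\<^esub> projr (hd x))]" for h x
  have lin: "linord (carrier H) hleq"
    and inv: "\<And>g x y. g \<in> carrier H \<Longrightarrow> x \<in> carrier H \<Longrightarrow> y \<in> carrier H \<Longrightarrow> hleq x y \<Longrightarrow>
      hleq (g \<otimes>\<^bsub>H\<^esub> x) (g \<otimes>\<^bsub>H\<^esub> y)"
    using hleq(1) unfolding left_order_iff by auto
  have "linord X leq"
    unfolding leq_def by (rule linord_image[OF lin]) (auto simp: X_def inj_on_def)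
  moreover have "ordered_action H X leq \<alpha>"
    unfolding ordered_action_def X_def \<alpha>_def leq_def using inv by (auto simp: H.m_assoc)
  moreover have "cls (\<alpha> h x) = left_mult (Inr h) (cls x)" if h: "h \<in> carrier H" and x: "x \<in> X" for h x
  proof -
    obtain k where k: "k \<in> carrier H" "x = [Inr k]" using x unfolding X_def by blast
    have "rel [Inr h, Inr k] [Inr (h \<otimes>\<^bsub>H\<^esub> k)]" by (rule amal_rel.mult_H[OF h k(1)])
    then have "cls [Inr h, Inr k] = cls (\<alpha> h x)"
      using cls_eq_iff h k unfolding \<alpha>_def by simp
    then show ?thesis using left_mult_cls[of "Inr h" x] h k by simp
  qed
  moreover have "ordered_action G {} leq \<beta>" for \<beta> unfolding ordered_action_def by simp
  moreover have "X \<subseteq> words" unfolding X_def by auto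
  \<comment> \<open>Any map is an action on the empty set, hence the arbitrary value for the action
    of \<open>G\<close>.\<close>
  ultimately have "tower_stage 1 ({}, X, leq, undefined, \<alpha>)"
    unfolding tower_stage_def stage_def by (auto simp: X_def)
  then show ?thesis by blast
qed

lemma left_mult_closed: "[s] \<in> words \<Longrightarrow> A \<in> cls ` words \<Longrightarrow> left_mult s A \<in> cls ` words"
  using left_mult_cls words_append[of "[s]"] by force

lemma left_mult_rel:
  assumes "rel [s] u" "A \<in> cls ` words"
  shows "left_mult s A = {w. \<exists>a\<in>A. rel (u @ a) w}"
proof -
  have "rel (s # a) w \<longleftrightarrow> rel (u @ a) w" if "a \<in> A" for a w
  proof -
    have "a \<in> words" using that assms(2) rel_words unfolding cls_def by auto
    then have "rel (s # a) (u @ a)" using rel_append_right[OF assms(1)] by simp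
    then show ?thesis by (meson amal_rel.sym amal_rel.trans)
  qed
  then show ?thesis unfolding left_mult_def by blast
qed

lemma left_mult_mult:
  assumes "rel [s, t] [s']" "A \<in> cls ` words"
  shows "left_mult s' A = left_mult s (left_mult t A)"
proof -
  obtain a where a: "a \<in> words" "A = cls a" using assms(2) by blast
  have st: "s # t # a \<in> words" "t # a \<in> words" "s' # a \<in> words"
    using rel_words[OF assms(1)] a(1) words_append[of "[s, t]" a] words_append[of "[s]" "[t]"]
      words_append[of "[t]" a] words_append[of "[s']" a] by auto
  have "rel (s # t # a) (s' # a)" using rel_append_right[OF assms(1) a(1)] by simp
  then show ?thesis using a st by (simp add: left_mult_cls cls_eq_iff[symmetric])
qed

text \<open>One round extends first the action of \<open>G\<close> to some \<open>Y\<close>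
  containing \<open>X\<close>, then that of \<open>H\<close> to some \<open>Z\<close> containing
  \<open>Y\<close>. Each half adds one letter, hence \<open>n + 2\<close>.\<close>

lemma tower_step:
  assumes "tower_stage n (X', X, leq, \<beta>, \<alpha>)"
  obtains Y Z leq' \<beta>' \<alpha>' where "tower_stage (n + 2) (Y, Z, leq', \<beta>', \<alpha>')" "X \<subseteq> Y"
    "\<And>x y. x \<in> X \<Longrightarrow> y \<in> X \<Longrightarrow> leq' x y = leq x y"
    "\<And>g x. g \<in> carrier G \<Longrightarrow> x \<in> X' \<Longrightarrow> \<beta>' g x = \<beta> g x"
    "\<And>h x. h \<in> carrier H \<Longrightarrow> x \<in> X \<Longrightarrow> \<alpha>' h x = \<alpha> h x"
proof -
  let ?W = "cls ` words" and ?LG = "left_mult \<circ> Inl" and ?LH = "left_mult \<circ> Inr"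
  have st: "stage G H (\<phi> c) (\<psi> c) ?LG ?LH ?W cls X' X leq \<beta> \<alpha>"
    and X: "X \<subseteq> words" "\<forall>x\<in>X. length x \<le> n" "\<forall>x\<in>X - X'. length x = n" "[Inr \<one>\<^bsub>H\<^esub>] \<in> X"
    using assms unfolding tower_stage_def by auto
  have zG: "\<phi> c \<in> carrier G" and zH: "\<psi> c \<in> carrier H" using c \<phi>_closed \<psi>_closed by auto
  have LGH: "?LG (\<phi> c [^]\<^bsub>G\<^esub> (k::int)) A = ?LH (\<psi> c [^]\<^bsub>H\<^esub> k) A" if "A \<in> ?W" for k A
    using left_mult_rel[OF rel_pow that] unfolding left_mult_def by simp
  have LG: "?LG g A \<in> ?W" "?LG (g \<otimes>\<^bsub>G\<^esub> h) A = ?LG g (?LG h A)"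
    if "g \<in> carrier G" "h \<in> carrier G" "A \<in> ?W" for g h A
    using that left_mult_closed left_mult_mult[OF amal_rel.mult_G] by auto
  have LH: "?LH g A \<in> ?W" "?LH (g \<otimes>\<^bsub>H\<^esub> h) A = ?LH g (?LH h A)"
    if "g \<in> carrier H" "h \<in> carrier H" "A \<in> ?W" for g h A
    using that left_mult_closed left_mult_mult[OF amal_rel.mult_H] by auto
  \<comment> \<open>Here \<open>p\<close> has length exactly \<open>n\<close>, so the prefixed word
    is longer than every word of \<open>X\<close>.\<close>
  have fresh1: "Inl g # p \<notin> X" if "p \<in> X - X'" for g p
    using that X(2,3) by force
  have new1: "cls (Inl g # p) = ?LG g (cls p)" if "g \<in> carrier G" "p \<in> X" for g p
    using that X(1) by (auto simp: left_mult_cls)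
  obtain Y leq1 \<beta>' where Y: "stage H G (\<psi> c) (\<phi> c) ?LH ?LG ?W cls X Y leq1 \<alpha> \<beta>'"
    "Y \<subseteq> X \<union> {Inl g # p | g p. g \<in> carrier G \<and> p \<in> X - X'}"
    "\<And>x y. x \<in> X \<Longrightarrow> y \<in> X \<Longrightarrow> leq1 x y = leq x y"
    "\<And>g x. g \<in> carrier G \<Longrightarrow> x \<in> X' \<Longrightarrow> \<beta>' g x = \<beta> g x"
    by (rule stage_extend[OF G.is_group H.is_group gleq(1) zG gleq(2) zH _ _ _ _ st, of "\<lambda>g p. Inl g # p"])
      (use pow_one_iff LGH LG fresh1 new1 in simp_all)
  have XY: "X \<subseteq> Y" using Y(1) unfolding stage_def by blast
  have Yw: "Y \<subseteq> words" "\<forall>x\<in>Y. length x \<le> n + 1" "\<forall>x\<in>Y - X. length x = n + 1"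
    using Y(2) X by force+
  have fresh2: "Inr h # p \<notin> Y" if "p \<in> Y - X" for h p
    using that Yw(2,3) by force
  have new2: "cls (Inr h # p) = ?LH h (cls p)" if "h \<in> carrier H" "p \<in> Y" for h p
    using that Yw(1) by (auto simp: left_mult_cls)
  obtain Z leq' \<alpha>' where Z: "stage G H (\<phi> c) (\<psi> c) ?LG ?LH ?W cls Y Z leq' \<beta>' \<alpha>'"
    "Z \<subseteq> Y \<union> {Inr h # p | h p. h \<in> carrier H \<and> p \<in> Y - X}"
    "\<And>x y. x \<in> Y \<Longrightarrow> y \<in> Y \<Longrightarrow> leq' x y = leq1 x y"
    "\<And>h x. h \<in> carrier H \<Longrightarrow> x \<in> X \<Longrightarrow> \<alpha>' h x = \<alpha> h x"
    by (rule stage_extend[OF H.is_group G.is_group hleq(1) zH hleq(2) zG _ _ _ _ Y(1), of "\<lambda>h p. Inr h # p"])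
      (use pow_one_iff LGH LH fresh2 new2 in simp_all)
  have YZ: "Y \<subseteq> Z" using Z(1) unfolding stage_def by blast
  have "Z \<subseteq> words" "\<forall>x\<in>Z. length x \<le> n + 2" "\<forall>x\<in>Z - Y. length x = n + 2"
    using Z(2) Yw by force+
  then have "tower_stage (n + 2) (Y, Z, leq', \<beta>', \<alpha>')"
    using Z(1) XY YZ X(4) unfolding tower_stage_def by auto
  moreover have "leq' x y = leq x y" if "x \<in> X" "y \<in> X" for x y
    using Y(3) Z(3) XY that by (metis subsetD)
  ultimately show ?thesis by (intro that[of Y Z leq' \<beta>' \<alpha>']) (use XY Y(4) Z(4) in auto)
qed

lemma tower_exists:
  obtains X' X leq \<beta> \<alpha> where
    "\<And>n. tower_stage (2 * n + 1) (X' n, X n, leq n, \<beta> n, \<alpha> n)"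
    "\<And>n. X n \<subseteq> X' (Suc n)"
    "\<And>n x y. x \<in> X n \<Longrightarrow> y \<in> X n \<Longrightarrow> leq (Suc n) x y = leq n x y"
    "\<And>n g x. g \<in> carrier G \<Longrightarrow> x \<in> X' n \<Longrightarrow> \<beta> (Suc n) g x = \<beta> n g x"
    "\<And>n h x. h \<in> carrier H \<Longrightarrow> x \<in> X n \<Longrightarrow> \<alpha> (Suc n) h x = \<alpha> n h x"
proof -
  define extends :: "('g, 'h) tower \<Rightarrow> ('g, 'h) tower \<Rightarrow> bool" where "extends = (\<lambda>(X', X, leq, \<beta>, \<alpha>) (Y, Z, leq', \<beta>', \<alpha>').
    X \<subseteq> Y \<and> (\<forall>x\<in>X. \<forall>y\<in>X. leq' x y = leq x y) \<and>
    (\<forall>g\<in>carrier G. \<forall>x\<in>X'. \<beta>' g x = \<beta> g x) \<and> (\<forall>h\<in>carrier H. \<forall>x\<in>X. \<alpha>' h x = \<alpha> h x))"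
  have "\<exists>s. \<forall>n. tower_stage (2 * n + 1) (s n) \<and> extends (s n) (s (Suc n))"
  proof (rule dependent_nat_choice)
    show "\<exists>s. tower_stage (2 * 0 + 1) s" using tower_start by simp
    fix s n assume st: "tower_stage (2 * n + 1) s"
    obtain X' X leq \<beta> \<alpha> where s: "s = (X', X, leq, \<beta>, \<alpha>)" by (cases s)
    obtain Y Z leq' \<beta>' \<alpha>' where t: "tower_stage (2 * n + 1 + 2) (Y, Z, leq', \<beta>', \<alpha>')" "X \<subseteq> Y"
      "\<And>x y. x \<in> X \<Longrightarrow> y \<in> X \<Longrightarrow> leq' x y = leq x y"
      "\<And>g x. g \<in> carrier G \<Longrightarrow> x \<in> X' \<Longrightarrow> \<beta>' g x = \<beta> g x"
      "\<And>h x. h \<in> carrier H \<Longrightarrow> x \<in> X \<Longrightarrow> \<alpha>' h x = \<alpha> h x"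
      using tower_step[OF st[unfolded s]] by blast
    have "extends s (Y, Z, leq', \<beta>', \<alpha>')" unfolding extends_def s using t(2-5) by simp
    moreover have "tower_stage (2 * Suc n + 1) (Y, Z, leq', \<beta>', \<alpha>')" using t(1) by simp
    ultimately show "\<exists>t. tower_stage (2 * Suc n + 1) t \<and> extends s t" by blast
  qed
  then obtain s where s: "\<And>n. tower_stage (2 * n + 1) (s n)" "\<And>n. extends (s n) (s (Suc n))" by blast
  show ?thesis
    by (rule that[of "\<lambda>n. fst (s n)" "\<lambda>n. fst (snd (s n))" "\<lambda>n. fst (snd (snd (s n)))"
          "\<lambda>n. fst (snd (snd (snd (s n))))" "\<lambda>n. snd (snd (snd (snd (s n))))"])
      (use s(1) s(2)[unfolded extends_def case_prod_beta] in simp_all)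
qed

text \<open>The union of the tower. The sets \<open>X' n\<close> and \<open>X n\<close> interlace,
  so both groups act on the entire union.\<close>

lemma ordered_set_exists:
  obtains \<Omega> leq \<beta> \<alpha> where
    "linord \<Omega> leq" "ordered_action G \<Omega> leq \<beta>" "ordered_action H \<Omega> leq \<alpha>"
    "\<And>k x. x \<in> \<Omega> \<Longrightarrow> \<beta> (\<phi> c [^]\<^bsub>G\<^esub> (k::int)) x = \<alpha> (\<psi> c [^]\<^bsub>H\<^esub> k) x"
    "\<Omega> \<subseteq> words" "[Inr \<one>\<^bsub>H\<^esub>] \<in> \<Omega>"
    "\<And>g x. g \<in> carrier G \<Longrightarrow> x \<in> \<Omega> \<Longrightarrow> rel (\<beta> g x) (Inl g # x)"
    "\<And>h x. h \<in> carrier H \<Longrightarrow> x \<in> \<Omega> \<Longrightarrow> rel (\<alpha> h x) (Inr h # x)"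
proof -
  obtain X' X leqs \<beta>s \<alpha>s where
    st: "\<And>n. tower_stage (2 * n + 1) (X' n, X n, leqs n, \<beta>s n, \<alpha>s n)"
    and XX': "\<And>n. X n \<subseteq> X' (Suc n)"
    and leqs: "\<And>n x y. x \<in> X n \<Longrightarrow> y \<in> X n \<Longrightarrow> leqs (Suc n) x y = leqs n x y"
    and \<beta>s: "\<And>n g x. g \<in> carrier G \<Longrightarrow> x \<in> X' n \<Longrightarrow> \<beta>s (Suc n) g x = \<beta>s n g x"
    and \<alpha>s: "\<And>n h x. h \<in> carrier H \<Longrightarrow> x \<in> X n \<Longrightarrow> \<alpha>s (Suc n) h x = \<alpha>s n h x"
    by (fact tower_exists)
  have X'X: "X' n \<subseteq> X n" and lin: "linord (X n) (leqs n)"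
    and actG: "ordered_action G (X' n) (leqs n) (\<beta>s n)" and actH: "ordered_action H (X n) (leqs n) (\<alpha>s n)"
    and z: "\<And>k x. x \<in> X' n \<Longrightarrow> \<beta>s n (\<phi> c [^]\<^bsub>G\<^esub> (k::int)) x = \<alpha>s n (\<psi> c [^]\<^bsub>H\<^esub> k) x"
    and clsG: "\<And>g x. g \<in> carrier G \<Longrightarrow> x \<in> X' n \<Longrightarrow> cls (\<beta>s n g x) = left_mult (Inl g) (cls x)"
    and clsH: "\<And>h x. h \<in> carrier H \<Longrightarrow> x \<in> X n \<Longrightarrow> cls (\<alpha>s n h x) = left_mult (Inr h) (cls x)"
    and words: "X n \<subseteq> words" and start: "[Inr \<one>\<^bsub>H\<^esub>] \<in> X n" for n
    using st[of n] unfolding tower_stage_def stage_def by auto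
  have X'_Suc: "X' n \<subseteq> X' (Suc n)" and X_Suc: "X n \<subseteq> X (Suc n)" for n
    using X'X XX' by blast+
  \<comment> \<open>Pairs serve as arguments because \<open>chain_limit\<close> treats functions of
    one variable; the domains make values matter only where the stage is defined.\<close>
  obtain leq2 where leq2: "\<And>n p. p \<in> X n \<times> X n \<Longrightarrow> leq2 p = (\<lambda>(x, y). leqs n x y) p"
    by (rule chain_limit[of "\<lambda>n. X n \<times> X n" "\<lambda>n (x, y). leqs n x y"]) (use X_Suc leqs in auto)
  obtain \<beta>2 where \<beta>2: "\<And>n p. p \<in> carrier G \<times> X' n \<Longrightarrow> \<beta>2 p = (\<lambda>(g, x). \<beta>s n g x) p"
    by (rule chain_limit[of "\<lambda>n. carrier G \<times> X' n" "\<lambda>n (g, x). \<beta>s n g x"]) (use X'_Suc \<beta>s in auto)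
  obtain \<alpha>2 where \<alpha>2: "\<And>n p. p \<in> carrier H \<times> X n \<Longrightarrow> \<alpha>2 p = (\<lambda>(h, x). \<alpha>s n h x) p"
    by (rule chain_limit[of "\<lambda>n. carrier H \<times> X n" "\<lambda>n (h, x). \<alpha>s n h x"]) (use X_Suc \<alpha>s in auto)
  define leq \<beta> \<alpha> where "leq x y = leq2 (x, y)" and "\<beta> g x = \<beta>2 (g, x)" and "\<alpha> h x = \<alpha>2 (h, x)"
    for x y g h
  have leq: "leq x y = leqs n x y" if "x \<in> X n" "y \<in> X n" for n x y
    using leq2[of "(x, y)" n] that by (simp add: leq_def)
  have \<beta>: "\<beta> g x = \<beta>s n g x" if "g \<in> carrier G" "x \<in> X' n" for n g x
    using \<beta>2[of "(g, x)" n] that by (simp add: \<beta>_def)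
  have \<alpha>: "\<alpha> h x = \<alpha>s n h x" if "h \<in> carrier H" "x \<in> X n" for n h x
    using \<alpha>2[of "(h, x)" n] that by (simp add: \<alpha>_def)
  define \<Omega> where "\<Omega> = (\<Union>n. X' n)"
  have X\<Omega>: "X n \<subseteq> \<Omega>" for n using XX' unfolding \<Omega>_def by blast
  \<comment> \<open>Order axioms and monotonicity concern at most three points, so each can be
    checked at one stage containing them.\<close>
  have common: "\<exists>n. x \<in> X' n \<and> y \<in> X' n \<and> w \<in> X' n" if xyw: "x \<in> \<Omega>" "y \<in> \<Omega>" "w \<in> \<Omega>" for x y w
  proof -
    obtain i j k where ijk: "x \<in> X' i" "y \<in> X' j" "w \<in> X' k" using xyw unfolding \<Omega>_def by blast
    have up: "X' m \<subseteq> X' n" if "m \<le> n" for m n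
      using lift_Suc_mono_le[of X'] X'_Suc that by blast
    have "X' i \<subseteq> X' (max i (max j k))" "X' j \<subseteq> X' (max i (max j k))" "X' k \<subseteq> X' (max i (max j k))"
      by (intro up; simp)+
    then show ?thesis using ijk by blast
  qed
  have "linord \<Omega> leq"
  proof (rule linordI)
    fix x assume "x \<in> \<Omega>"
    then obtain n where n: "x \<in> X n" using X'X unfolding \<Omega>_def by blast
    show "leq x x" using leq[OF n n] linord_refl[OF lin n] by simp
  next
    fix x y assume xy: "x \<in> \<Omega>" "y \<in> \<Omega>"
    obtain n where "x \<in> X' n" "y \<in> X' n" using common[OF xy(1) xy] by blast
    then have n: "x \<in> X n" "y \<in> X n" using X'X by auto
    show "leq x y \<or> leq y x" using leq[OF n] leq[OF n(2,1)] linord_total[OF lin n] by simp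
    assume "leq x y" "leq y x"
    then show "x = y" using leq[OF n] leq[OF n(2,1)] linord_antisym[OF lin _ _ n] by simp
  next
    fix x y w assume xyw: "x \<in> \<Omega>" "y \<in> \<Omega>" "w \<in> \<Omega>" and l: "leq x y" "leq y w"
    obtain n where "x \<in> X' n" "y \<in> X' n" "w \<in> X' n" using common[OF xyw] by blast
    then have n: "x \<in> X n" "y \<in> X n" "w \<in> X n" using X'X by auto
    show "leq x w"
      using l leq[OF n(1,2)] leq[OF n(2,3)] leq[OF n(1,3)] linord_trans[OF lin _ _ n] by simp
  qed
  have "ordered_action G \<Omega> leq \<beta>"
  proof -
    have "\<beta> g x \<in> \<Omega> \<and> \<beta> \<one>\<^bsub>G\<^esub> x = x \<and> (\<beta> g x = x \<longrightarrow> g = \<one>\<^bsub>G\<^esub>) \<and>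
        (\<forall>h\<in>carrier G. \<beta> (h \<otimes>\<^bsub>G\<^esub> g) x = \<beta> h (\<beta> g x))" if g: "g \<in> carrier G" and x: "x \<in> \<Omega>" for g x
    proof -
      obtain n where n: "x \<in> X' n" using x unfolding \<Omega>_def by blast
      have cl: "\<beta>s n g x \<in> X' n" by (rule ordered_action_closed[OF actG g n])
      have "\<beta> (h \<otimes>\<^bsub>G\<^esub> g) x = \<beta> h (\<beta> g x)" if "h \<in> carrier G" for h
        using g that \<beta>[OF _ n] \<beta>[OF _ cl] ordered_action_mult[OF actG that g n] by simp
      moreover have "\<beta> g x \<in> \<Omega>" using \<beta>[OF g n] cl unfolding \<Omega>_def by auto
      ultimately show ?thesis
        using \<beta>[OF _ n] g ordered_action_one[OF actG n] ordered_action_free[OF actG g n] by simp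
    qed
    moreover have "leq (\<beta> g x) (\<beta> g y)" if g: "g \<in> carrier G" and xy: "x \<in> \<Omega>" "y \<in> \<Omega>" and l: "leq x y" for g x y
    proof -
      obtain n where n: "x \<in> X' n" "y \<in> X' n" using common[OF xy(1) xy] by blast
      have cl: "\<beta>s n g x \<in> X n" "\<beta>s n g y \<in> X n"
        using ordered_action_closed[OF actG g] n X'X by auto
      have "leqs n x y" using l leq[of x n y] n X'X by auto
      then show ?thesis
        using ordered_action_mono[OF actG g n] leq[OF cl] \<beta>[OF g n(1)] \<beta>[OF g n(2)] by simp
    qed
    ultimately show ?thesis unfolding ordered_action_def using G.one_closed by auto
  qed
  have "ordered_action H \<Omega> leq \<alpha>"
  proof -
    have "\<alpha> g x \<in> \<Omega> \<and> \<alpha> \<one>\<^bsub>H\<^esub> x = x \<and> (\<alpha> g x = x \<longrightarrow> g = \<one>\<^bsub>H\<^esub>) \<and>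
        (\<forall>h\<in>carrier H. \<alpha> (h \<otimes>\<^bsub>H\<^esub> g) x = \<alpha> h (\<alpha> g x))" if g: "g \<in> carrier H" and x: "x \<in> \<Omega>" for g x
    proof -
      obtain n where n: "x \<in> X n" using x X'X unfolding \<Omega>_def by blast
      have cl: "\<alpha>s n g x \<in> X n" by (rule ordered_action_closed[OF actH g n])
      have "\<alpha> (h \<otimes>\<^bsub>H\<^esub> g) x = \<alpha> h (\<alpha> g x)" if "h \<in> carrier H" for h
        using g that \<alpha>[OF _ n] \<alpha>[OF _ cl] ordered_action_mult[OF actH that g n] by simp
      moreover have "\<alpha> g x \<in> \<Omega>" using \<alpha>[OF g n] cl X\<Omega> by auto
      ultimately show ?thesis
        using \<alpha>[OF _ n] g ordered_action_one[OF actH n] ordered_action_free[OF actH g n] by simp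
    qed
    moreover have "leq (\<alpha> g x) (\<alpha> g y)" if g: "g \<in> carrier H" and xy: "x \<in> \<Omega>" "y \<in> \<Omega>" and l: "leq x y" for g x y
    proof -
      obtain n where "x \<in> X' n" "y \<in> X' n" using common[OF xy(1) xy] by blast
      then have n: "x \<in> X n" "y \<in> X n" using X'X by auto
      have cl: "\<alpha>s n g x \<in> X n" "\<alpha>s n g y \<in> X n"
        using ordered_action_closed[OF actH g] n by auto
      show ?thesis
        using ordered_action_mono[OF actH g n] l leq[OF n] leq[OF cl] \<alpha>[OF g n(1)] \<alpha>[OF g n(2)] by simp
    qed
    ultimately show ?thesis unfolding ordered_action_def using H.one_closed by auto
  qed
  have "\<beta> (\<phi> c [^]\<^bsub>G\<^esub> (k::int)) x = \<alpha> (\<psi> c [^]\<^bsub>H\<^esub> k) x" if "x \<in> \<Omega>" for k x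
  proof -
    obtain n where "x \<in> X' n" using \<open>x \<in> \<Omega>\<close> unfolding \<Omega>_def by blast
    then show ?thesis using \<beta>[of _ x n] \<alpha>[of _ x n] z X'X[of n] c \<phi>_closed \<psi>_closed by auto
  qed
  have "\<Omega> \<subseteq> words" unfolding \<Omega>_def using X'X words by blast
  have "[Inr \<one>\<^bsub>H\<^esub>] \<in> \<Omega>" using start X\<Omega> by blast
  have "rel (\<beta> g x) (Inl g # x)" if g: "g \<in> carrier G" and x: "x \<in> \<Omega>" for g x
  proof -
    obtain n where n: "x \<in> X' n" using x unfolding \<Omega>_def by blast
    then have "x \<in> words" using X'X words by blast
    then have "cls (\<beta> g x) = cls (Inl g # x)" using clsG[OF g n] \<beta>[OF g n] g by (simp add: left_mult_cls)
    moreover have "\<beta> g x \<in> words"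
      using ordered_action_closed[OF actG g n] \<beta>[OF g n] X'X words by auto
    ultimately show ?thesis using cls_eq_iff by blast
  qed
  have "rel (\<alpha> h x) (Inr h # x)" if h: "h \<in> carrier H" and x: "x \<in> \<Omega>" for h x
  proof -
    obtain n where n: "x \<in> X n" using x X'X unfolding \<Omega>_def by blast
    then have "x \<in> words" using words by blast
    then have "cls (\<alpha> h x) = cls (Inr h # x)" using clsH[OF h n] \<alpha>[OF h n] h by (simp add: left_mult_cls)
    moreover have "\<alpha> h x \<in> words"
      using ordered_action_closed[OF actH h n] \<alpha>[OF h n] words by auto
    ultimately show ?thesis using cls_eq_iff by blast
  qed
  show ?thesis by (rule that[of \<Omega> leq \<beta> \<alpha>]) fact+
qed

text \<open>Words act on \<open>\<Omega>\<close> through the letters. The orbit map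
  \<open>ev\<close> at \<open>[Inr \<one>]\<close> separates classes because \<open>ev w\<close>,
  itself a word, represents the same element as \<open>w\<close>. The order of
  \<open>\<Omega>\<close> is pulled back along it.\<close>

lemma left_orderable_product: "left_orderable (amalgamated_product G H C \<phi> \<psi>)"
proof -
  obtain \<Omega> leq \<beta> \<alpha> where lin: "linord \<Omega> leq" and \<beta>: "ordered_action G \<Omega> leq \<beta>" and \<alpha>: "ordered_action H \<Omega> leq \<alpha>"
    and z: "\<And>k x. x \<in> \<Omega> \<Longrightarrow> \<beta> (\<phi> c [^]\<^bsub>G\<^esub> (k::int)) x = \<alpha> (\<psi> c [^]\<^bsub>H\<^esub> k) x"
    and \<Omega>: "\<Omega> \<subseteq> words" "[Inr \<one>\<^bsub>H\<^esub>] \<in> \<Omega>"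
    and rel\<beta>: "\<And>g x. g \<in> carrier G \<Longrightarrow> x \<in> \<Omega> \<Longrightarrow> rel (\<beta> g x) (Inl g # x)"
    and rel\<alpha>: "\<And>h x. h \<in> carrier H \<Longrightarrow> x \<in> \<Omega> \<Longrightarrow> rel (\<alpha> h x) (Inr h # x)"
    by (fact ordered_set_exists)
  define act where "act w x = foldr (case_sum \<beta> \<alpha>) w x" for w x
  have act_simps: "act [] x = x" "act (Inl g # w) x = \<beta> g (act w x)" "act (Inr h # w) x = \<alpha> h (act w x)"
    "act (u @ v) x = act u (act v x)" for g h u v w x
    by (simp_all add: act_def)
  have letter: "(\<exists>g\<in>carrier G. s = Inl g) \<or> (\<exists>h\<in>carrier H. s = Inr h)" if "s # w \<in> words" for s w
    using that by (cases s) auto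
  have act_closed: "act w x \<in> \<Omega>" if "w \<in> words" "x \<in> \<Omega>" for w x
    using that
  proof (induction w)
    case (Cons s w)
    then show ?case using letter[of s w] ordered_action_closed[OF \<beta>] ordered_action_closed[OF \<alpha>]
      by (auto simp: act_simps)
  qed (simp add: act_simps)
  have act_mono: "leq (act w x) (act w y)" if "w \<in> words" "x \<in> \<Omega>" "y \<in> \<Omega>" "leq x y" for w x y
    using that
  proof (induction w)
    case (Cons s w)
    then show ?case using letter[of s w] ordered_action_mono[OF \<beta>] ordered_action_mono[OF \<alpha>] act_closed
      by (auto simp: act_simps)
  qed (simp add: act_simps)
  \<comment> \<open>The action respects the defining relations. For the amalgamation every element
    of \<open>C\<close> is a power of \<open>c\<close>, on which the two actions agree.\<close>
  have act_rel: "act u x = act v x" if "rel u v" "x \<in> \<Omega>" for u v x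
    using that
  proof (induction arbitrary: x rule: amal_rel.induct)
    case (cong u v a b)
    then show ?case using act_closed by (simp add: act_simps)
  next
    case (mult_G g h)
    then show ?case using ordered_action_mult[OF \<beta>] by (simp add: act_simps)
  next
    case (mult_H g h)
    then show ?case using ordered_action_mult[OF \<alpha>] by (simp add: act_simps)
  next
    case (amalg d)
    then obtain k :: int where "d = c [^]\<^bsub>C\<^esub> k" using c(2) by auto
    then show ?case
      using z[OF \<open>x \<in> \<Omega>\<close>, of k] hom_int_pow[OF \<phi>(1) c(1) C.is_group G.is_group]
        hom_int_pow[OF \<psi>(1) c(1) C.is_group H.is_group] by (simp add: act_simps)
  qed (use ordered_action_one[OF \<beta>] ordered_action_one[OF \<alpha>] in \<open>auto simp: act_simps\<close>)
  have rel_act: "rel (act w x) (w @ x)" if "w \<in> words" "x \<in> \<Omega>" for w x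
    using that
  proof (induction w)
    case Nil
    then show ?case using \<Omega>(1) by (auto simp: act_simps intro!: amal_rel.refl)
  next
    case (Cons s w)
    have sw: "[s] \<in> words" "w \<in> words" using Cons.prems words_append[of "[s]" w] by auto
    have "rel (act (s # w) x) (s # act w x)"
      using letter[OF Cons.prems(1)] rel\<beta> rel\<alpha> act_closed[OF sw(2) Cons.prems(2)] by (auto simp: act_simps)
    moreover have "rel (s # act w x) ((s # w) @ x)"
      using rel_append_left[OF Cons.IH[OF sw(2) Cons.prems(2)] sw(1)] by simp
    ultimately show ?case by (rule amal_rel.trans)
  qed
  define ev where "ev w = act w [Inr \<one>\<^bsub>H\<^esub>]" for w
  have ev_closed: "ev w \<in> \<Omega>" if "w \<in> words" for w
    unfolding ev_def by (rule act_closed[OF that \<Omega>(2)])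
  have rel_ev: "rel (ev w) w" if "w \<in> words" for w
    using rel_act[OF that \<Omega>(2)] rel_append_left[OF amal_rel.one_H that] unfolding ev_def
    by (simp add: amal_rel.trans[of G H C \<phi> \<psi> _ "w @ [Inr \<one>\<^bsub>H\<^esub>]"])
  \<comment> \<open>Triviality of the stabilizer: the value \<open>ev w\<close> determines the class
    of \<open>w\<close>, and conversely related words act alike.\<close>
  have ev_eq_iff: "ev u = ev v \<longleftrightarrow> rel u v" if "u \<in> words" "v \<in> words" for u v
    using rel_ev[OF that(1)] rel_ev[OF that(2)] act_rel[OF _ \<Omega>(2), of u v] unfolding ev_def
    by (metis amal_rel.sym amal_rel.trans)
  let ?K = "amalgamated_product G H C \<phi> \<psi>"
  have carrier: "carrier ?K = cls ` words"
    unfolding amalgamated_product_def quotient_def cls_def by auto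
  have mult: "cls u \<otimes>\<^bsub>?K\<^esub> cls v = cls (u @ v)" if "u \<in> words" "v \<in> words" for u v
  proof -
    have "rel (u @ v) (a @ b)" if "rel u a" "rel v b" for a b using rel_append that by blast
    moreover have "rel u u" "rel v v" using that amal_rel.refl by blast+
    ultimately show ?thesis unfolding amalgamated_product_def cls_def
      by (auto intro: amal_rel.trans amal_rel.sym)
  qed
  \<comment> \<open>Existential quantifiers are harmless, \<open>ev\<close> being constant on each
    class.\<close>
  define ord where "ord A B \<longleftrightarrow> (\<exists>a\<in>A. \<exists>b\<in>B. leq (ev a) (ev b))" for A B
  have ord: "ord (cls u) (cls v) \<longleftrightarrow> leq (ev u) (ev v)" if uv: "u \<in> words" "v \<in> words" for u v
  proof -
    have "ev a = ev w" if "a \<in> cls w" for a w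
      using that act_rel[OF _ \<Omega>(2)] unfolding cls_def ev_def by simp
    moreover have "u \<in> cls u" "v \<in> cls v" using uv amal_rel.refl unfolding cls_def by blast+
    ultimately show ?thesis unfolding ord_def by metis
  qed
  have "left_order ?K ord"
    unfolding left_order_iff
  proof
    show "linord (carrier ?K) ord"
    proof (rule linordI)
      fix A assume "A \<in> carrier ?K"
      then show "ord A A" using ord linord_refl[OF lin ev_closed] unfolding carrier by auto
    next
      fix A B assume "A \<in> carrier ?K" "B \<in> carrier ?K"
      then obtain u v where uv: "u \<in> words" "v \<in> words" "A = cls u" "B = cls v" unfolding carrier by blast
      show "ord A B \<or> ord B A"
        using ord[of u v] ord[of v u] uv linord_total[OF lin ev_closed ev_closed] by simp
      assume "ord A B" "ord B A"
      then have "ev u = ev v"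
        using ord[of u v] ord[of v u] uv linord_antisym[OF lin _ _ ev_closed ev_closed] by simp
      then show "A = B" using uv ev_eq_iff cls_eq_iff by blast
    next
      fix A B D assume "A \<in> carrier ?K" "B \<in> carrier ?K" "D \<in> carrier ?K" and l: "ord A B" "ord B D"
      then obtain u v w where uvw: "u \<in> words" "v \<in> words" "w \<in> words" "A = cls u" "B = cls v" "D = cls w"
        unfolding carrier by blast
      have "leq (ev u) (ev v)" "leq (ev v) (ev w)" using l ord uvw by auto
      then have "leq (ev u) (ev w)"
        using linord_trans[OF lin _ _ ev_closed ev_closed ev_closed] uvw by blast
      then show "ord A D" using ord uvw by simp
    qed
    show "\<forall>A\<in>carrier ?K. \<forall>B\<in>carrier ?K. \<forall>D\<in>carrier ?K. ord B D \<longrightarrow>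
        ord (A \<otimes>\<^bsub>?K\<^esub> B) (A \<otimes>\<^bsub>?K\<^esub> D)"
    proof (intro ballI impI)
      fix A B D assume "A \<in> carrier ?K" "B \<in> carrier ?K" "D \<in> carrier ?K" and l: "ord B D"
      then obtain u v w where uvw: "u \<in> words" "v \<in> words" "w \<in> words" "A = cls u" "B = cls v" "D = cls w"
        unfolding carrier by blast
      have "leq (ev v) (ev w)" using l ord uvw by auto
      \<comment> \<open>Left multiplication by \<open>u\<close> corresponds to the action of
        \<open>u\<close> on orbit points, which is monotone.\<close>
      then have "leq (act u (ev v)) (act u (ev w))" using act_mono ev_closed uvw by blast
      then have "leq (ev (u @ v)) (ev (u @ w))" unfolding ev_def act_simps .
      then show "ord (A \<otimes>\<^bsub>?K\<^esub> B) (A \<otimes>\<^bsub>?K\<^esub> D)" using uvw by (simp add: mult ord)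
    qed
  qed
  then show ?thesis unfolding left_orderable_def by blast
qed

end

text \<open>Since \<open>C\<close> is generated by one element, compatibility of the two orders is
  only a matter of its sign, and reversing an order adjusts the sign.\<close>

theorem cyclic_amalgam_left_orderable:
  fixes G :: "'g monoid" and H :: "'h monoid" and C :: "'c monoid"
  assumes "group G" "left_orderable G" "group H" "left_orderable H" "group C" "cyclic_group C"
    and "\<phi> \<in> hom C G" "inj_on \<phi> (carrier C)" "\<psi> \<in> hom C H" "inj_on \<psi> (carrier C)"
  shows "left_orderable (amalgamated_product G H C \<phi> \<psi>)"
proof -
  obtain c where c: "c \<in> carrier C" "carrier C = range (\<lambda>n::int. c [^]\<^bsub>C\<^esub> n)"
    using group.cyclic_group[OF assms(5)] assms(6) by blast
  have "\<phi> c \<in> carrier G" "\<psi> c \<in> carrier H" using assms c by (auto simp: hom_def)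
  then obtain gleq hleq where "left_order G gleq" "gleq \<one>\<^bsub>G\<^esub> (\<phi> c)" "left_order H hleq" "hleq \<one>\<^bsub>H\<^esub> (\<psi> c)"
    using left_order_positive assms unfolding left_orderable_def by metis
  then interpret cyclic_amalgam G H C \<phi> \<psi> c gleq hleq
    using assms c by (intro cyclic_amalgam.intro cyclic_amalgam_axioms.intro)
  show ?thesis by (rule left_orderable_product)
qed

theorem theorem6p3:
  fixes G :: "'g monoid" and H :: "'h monoid" and C :: "'c monoid"
    and \<phi> :: "'c \<Rightarrow> 'g" and \<psi> :: "'c \<Rightarrow> 'h" and ord_rel :: "'g \<Rightarrow> 'g \<Rightarrow> bool"
  assumes "group G" and "left_order G ord_rel"
    and "group H" and "nilpotent H" and "torsion_free H"
    and "group C" and "cyclic_group C"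
    and "\<phi> \<in> hom C G" and "inj_on \<phi> (carrier C)"
    and "\<psi> \<in> hom C H" and "inj_on \<psi> (carrier C)"
  shows "left_orderable (amalgamated_product G H C \<phi> \<psi>)"
proof (rule cyclic_amalgam_left_orderable)
  show "left_orderable G" using assms(2) unfolding left_orderable_def by blast
  show "left_orderable H" by (rule group.torsion_free_nilpotent_left_orderable[OF assms(3-5)])
qed (fact assms)+

end
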